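(* Let $n$ be odd and square-free, with prime factorization $n=\prod_{j=1}^K p_j$, and write $Z_n=Z_{p_1}\times\cdots\times Z_{p_K}$. (1) Let $\sigma_j$ be a permutation of $Z_{p_j}$ for $1\le j\le K$, and let $\sigma=\sigma_1\times\cdots\times\sigma_K$ be the product permutation on $Z_n$, i.e. $\sigma(x_1,\dots,x_K)=(\sigma_1(x_1),\dots,\sigma_K(x_K))$. Then $\sigma$ preserves both the class of quasi-independent subsets of $Z_n$ and the class of independent subsets of $Z_n$. (2) Let $\sigma$ be a permutation of $Z_n$ that preserves either the class of quasi-independent subsets of $Z_n$ or the class of independent subsets of $Z_n$. Then $\sigma=\sigma_1\times\cdots\times\sigma_K$ for some permutations $\sigma_j$ of $Z_{p_j}$, $1\le j\le K$.
   Context: A subset $B$ of an additive abelian group is quasi-independent if, whenever $k\ge1$, $x_1,\dots,x_k\in B$ are distinct, $\epsilon_j\in\{0,1,-1\}$ and $\sum_j\epsilon_jx_j=0$, then all $\epsilon_j=0$. It is independent if, whenever $k\ge1$, $x_1,\dots,x_k\in B$ are distinct, $\epsilon_j\in\mathbb{Z}$ and $\sum_j\epsilon_jx_j=0$, then $\epsilon_jx_j=0$ for all $j$. Let $T_n\subset\mathbb{C}$ be the set of $n$-th roots of unity. The multiplicative group $T_n$ is identified with the additive cyclic group $Z_n$ of order $n$ (via $k\mapsto e^{2\pi i k/n}$), and $Z_n$ is identified with the direct product of its subgroups $Z_{p_j}$ of order $p_j$. A subset of $Z_n$ is called quasi-independent or independent if the corresponding subset of $T_n$ is so as a subset of the additive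 group $\mathbb{C}$ (not of the group $Z_n$). A permutation $\sigma$ of $Z_n$ preserves a class of subsets of $Z_n$ if, for every $E\subset Z_n$, $E$ is in the class if and only if $\sigma(E)$ is. *)

theory Defs
  imports
    Complex_Main
    "HOL-Algebra.Elementary_Groups"
    "HOL-Algebra.Multiplicative_Group"
    "HOL-Algebra.Product_Groups"
    "HOL-Combinatorics.Permutations"
    "HOL-Computational_Algebra.Squarefree"
begin

definition zmult :: "int \<Rightarrow> 'a::ab_group_add \<Rightarrow> 'a" where
  "zmult m x = (if m \<ge> 0 then ((+) x ^^ nat m) 0 else - (((+) x ^^ nat (- m)) 0))"

lemma zmult_of_int: "zmult m (x :: 'a::ring_1) = of_int m * x"
proof -
  have *: "((+) x ^^ k) 0 = of_nat k * x" for k :: nat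
    by (induction k) (auto simp: algebra_simps)
  show ?thesis
    by (simp add: zmult_def *)
qed

text \<open>Choosing distinct \<open>x\<^sub>1, \<dots>, x\<^sub>k \<in> B\<close> amounts to choosing a finite subset \<open>F\<close> of \<open>B\<close>,
  the coefficients becoming a function on \<open>F\<close>; \<open>F = {}\<close> contributes nothing.\<close>

definition quasi_independent :: "'a::ab_group_add set \<Rightarrow> bool" where
  "quasi_independent B \<longleftrightarrow>
     (\<forall>F e. finite F \<and> F \<subseteq> B \<and> (\<forall>x\<in>F. e x \<in> {0, 1, -1}) \<and> (\<Sum>x\<in>F. zmult (e x) x) = 0
        \<longrightarrow> (\<forall>x\<in>F. e x = 0))"

text \<open>The name \<open>independent\<close> already denotes linear independence over the reals.\<close>

definition int_independent :: "'a::ab_group_add set \<Rightarrow> bool" where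
  "int_independent B \<longleftrightarrow>
     (\<forall>F e. finite F \<and> F \<subseteq> B \<and> (\<Sum>x\<in>F. zmult (e x) x) = 0
        \<longrightarrow> (\<forall>x\<in>F. zmult (e x) x = 0))"

abbreviation Zn :: "nat \<Rightarrow> int set" where
  "Zn n \<equiv> carrier (integer_mod_group n)"

definition root_of_unity :: "nat \<Rightarrow> int \<Rightarrow> complex" where
  "root_of_unity n k = exp (2 * complex_of_real pi * \<i> * of_int k / of_nat n)"

lemma bij_betw_root_of_unity:
  assumes "n > 0"
  shows "bij_betw (root_of_unity n) (Zn n) {z. z ^ n = 1}"
proof -
  have 1: "bij_betw nat {0..<int n} {..<n}"
    by (rule bij_betwI[where g = int]) auto
  have "bij_betw ((\<lambda>k. cis (2 * pi * real k / real n)) \<circ> nat) {0..<int n} {z. z ^ n = 1}"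
    by (rule bij_betw_trans[OF 1 bij_betw_roots_unity[OF assms]])
  moreover have "((\<lambda>k. cis (2 * pi * real k / real n)) \<circ> nat) k = root_of_unity n k"
    if "k \<in> {0..<int n}" for k
    using that by (simp add: root_of_unity_def cis_conv_exp mult_ac)
  ultimately have "bij_betw (root_of_unity n) {0..<int n} {z. z ^ n = 1}"
    using bij_betw_cong[of "{0..<int n}" "(\<lambda>k. cis (2 * pi * real k / real n)) \<circ> nat" "root_of_unity n"]
    by blast
  thus ?thesis
    using assms by (simp add: carrier_integer_mod_group)
qed

definition Zn_quasi_independent :: "nat \<Rightarrow> int set \<Rightarrow> bool" where
  "Zn_quasi_independent n E \<longleftrightarrow> quasi_independent (root_of_unity n ` E)"

definition Zn_independent :: "nat \<Rightarrow> int set \<Rightarrow> bool" where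
  "Zn_independent n E \<longleftrightarrow> int_independent (root_of_unity n ` E)"

definition preserves_class :: "nat \<Rightarrow> (int \<Rightarrow> int) \<Rightarrow> (int set \<Rightarrow> bool) \<Rightarrow> bool" where
  "preserves_class n \<sigma> \<C> \<longleftrightarrow> (\<forall>E \<subseteq> Zn n. \<C> E \<longleftrightarrow> \<C> (\<sigma> ` E))"

text \<open>For \<open>d\<close> dividing \<open>n\<close> this is the subgroup of order \<open>d\<close>; see \<open>Zsub_unique\<close> below.\<close>

definition Zsub :: "nat \<Rightarrow> nat \<Rightarrow> int set" where
  "Zsub n d = {k \<in> Zn n. int (n div d) dvd k}"

lemma mem_Zn: "n > 0 \<Longrightarrow> k \<in> Zn n \<longleftrightarrow> 0 \<le> k \<and> k < int n"
  by (auto simp: carrier_integer_mod_group)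

lemma subgroup_Zsub:
  assumes "n > 0" "d dvd n"
  shows "subgroup (Zsub n d) (integer_mod_group n)"
proof -
  have dv: "int (n div d) dvd int n"
    using assms by (metis dvd_div_mult_self dvd_triv_left int_dvd_int_iff)
  interpret group "integer_mod_group n" by simp
  have m: "int (n div d) dvd k mod int n" if "int (n div d) dvd k" for k
    using that dv by (simp add: dvd_mod_iff)
  show ?thesis
  proof (rule subgroupI)
    show "Zsub n d \<subseteq> Zn n" by (auto simp: Zsub_def)
    have "0 \<in> Zsub n d" by (simp add: Zsub_def)
    thus "Zsub n d \<noteq> {}" by blast
    show "inv\<^bsub>integer_mod_group n\<^esub> a \<in> Zsub n d" if "a \<in> Zsub n d" for a
      using that m[of "- a"] assms(1) by (simp add: Zsub_def mem_Zn)
    show "a \<otimes>\<^bsub>integer_mod_group n\<^esub> b \<in> Zsub n d" if "a \<in> Zsub n d" "b \<in> Zsub n d" for a b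
      using that m[of "a + b"] assms(1) by (simp add: Zsub_def mem_Zn)
  qed
qed

lemma card_Zsub:
  assumes "n > 0" "d dvd n"
  shows "card (Zsub n d) = d"
proof -
  obtain c where c: "n = c * d" using assms by (metis dvd_div_mult_self)
  hence pos: "c > 0" "d > 0" using assms by auto
  have nd: "n div d = c" using c pos by simp
  have "bij_betw (\<lambda>k. int c * int k) {..<d} (Zsub n d)"
    unfolding Zsub_def nd
  proof (rule bij_betwI[where g = "\<lambda>k. nat (k div int c)"])
    show "(\<lambda>k. int c * int k) \<in> {..<d} \<rightarrow> {k \<in> Zn n. int c dvd k}"
      using assms pos by (auto simp: mem_Zn c simp flip: of_nat_mult)
    show "(\<lambda>k. nat (k div int c)) \<in> {k \<in> Zn n. int c dvd k} \<rightarrow> {..<d}"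
      using assms pos by (auto simp: mem_Zn c elim!: dvdE)
    show "nat (int c * int k div int c) = k" if "k \<in> {..<d}" for k
      using pos by simp
    show "int c * int (nat (k div int c)) = k" if "k \<in> {k \<in> Zn n. int c dvd k}" for k
      using that pos assms by (auto simp: mem_Zn pos_imp_zdiv_nonneg_iff)
  qed
  thus ?thesis using bij_betw_same_card by fastforce
qed

lemma Zsub_unique:
  assumes "n > 0" "subgroup H (integer_mod_group n)" "card H = d" "d dvd n"
  shows "H = Zsub n d"
proof -
  let ?G = "integer_mod_group n"
  let ?H = "?G\<lparr>carrier := H\<rparr>"
  interpret group ?G by simp
  have HZ: "H \<subseteq> Zn n" using assms(2) by (rule subgroup.subset)
  have fin: "finite (Zn n)" using assms by (simp add: carrier_integer_mod_group)
  have d0: "d > 0" using assms by (auto intro!: Nat.gr0I)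
  have "H \<subseteq> Zsub n d"
  proof
    fix x assume x: "x \<in> H"
    have gH: "group ?H" using assms(2) by (rule subgroup_imp_group)
    have "x [^]\<^bsub>?H\<^esub> order ?H = \<one>\<^bsub>?H\<^esub>"
      using group.pow_order_eq_1[OF gH, of x] x by simp
    hence "x [^]\<^bsub>?G\<^esub> d = \<one>\<^bsub>?G\<^esub>"
      using assms(3) by (simp add: order_def nat_pow_def)
    hence "int n dvd x * int d"
      by (simp add: pow_integer_mod_group mult.commute dvd_eq_mod_eq_0)
    moreover have "int n = int (n div d) * int d"
      using assms(4) by (metis dvd_div_mult_self of_nat_mult)
    ultimately have "int (n div d) dvd x" using d0 by simp
    thus "x \<in> Zsub n d" using x HZ by (auto simp: Zsub_def)
  qed
  moreover have "finite (Zsub n d)" using fin by (simp add: Zsub_def)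
  ultimately show ?thesis
    using assms card_Zsub by (metis card_subset_eq)
qed

text \<open>The identification of \<open>Z\<^sub>p\<^sub>1 \<times> \<dots> \<times> Z\<^sub>p\<^sub>K\<close> with \<open>Z\<^sub>n\<close> adds up the components in \<open>Z\<^sub>n\<close>.\<close>

abbreviation Zprod :: "nat \<Rightarrow> nat \<Rightarrow> (nat \<Rightarrow> nat) \<Rightarrow> (nat \<Rightarrow> int) set" where
  "Zprod n K p \<equiv> (\<Pi>\<^sub>E j\<in>{1..K}. Zsub n (p j))"

definition Zjoin :: "nat \<Rightarrow> nat \<Rightarrow> (nat \<Rightarrow> int) \<Rightarrow> int" where
  "Zjoin n K x = (\<Sum>j=1..K. x j) mod int n"

lemma bij_betw_Zjoin:
  assumes "squarefree n" "\<forall>j\<in>{1..K}. prime (p j)" "n = (\<Prod>j=1..K. p j)"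
  shows "bij_betw (Zjoin n K) (Zprod n K p) (Zn n)"
proof -
  have n0: "n > 0" using assms by (auto intro!: Nat.gr0I)
  have dvdn: "p j dvd n" if "j \<in> {1..K}" for j
    using that assms(3) by (auto intro: dvd_prodI)
  have quot: "n div p j = (\<Prod>i\<in>{1..K}-{j}. p i)" if "j \<in> {1..K}" for j
  proof -
    have "n = p j * (\<Prod>i\<in>{1..K}-{j}. p i)"
      using that assms(3) by (simp add: prod.remove)
    moreover have "p j > 0" using that assms(2) by (simp add: prime_gt_0_nat)
    ultimately show ?thesis by simp
  qed
  have inj: "inj_on (Zjoin n K) (Zprod n K p)"
  proof (rule inj_onI, rule PiE_ext)
    fix x y assume x: "x \<in> Zprod n K p" and y: "y \<in> Zprod n K p" and eq: "Zjoin n K x = Zjoin n K y"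
    show "x \<in> Zprod n K p" "y \<in> Zprod n K p" by fact+
    fix i assume i: "i \<in> {1..K}"
    have mem: "x j \<in> Zsub n (p j)" "y j \<in> Zsub n (p j)" if "j \<in> {1..K}" for j
      using x y that by auto
    define c where "c = n div p i"
    have nc: "n = c * p i" using dvdn[OF i] by (simp add: c_def)
    have "int n dvd (\<Sum>j=1..K. x j) - (\<Sum>j=1..K. y j)"
      using eq unfolding Zjoin_def by (simp add: mod_eq_dvd_iff)
    hence "int n dvd (\<Sum>j=1..K. x j - y j)" by (simp add: sum_subtractf)
    hence "int (p i) dvd (\<Sum>j=1..K. x j - y j)"
      using dvdn[OF i] by (meson dvd_trans int_dvd_int_iff)
    also have "(\<Sum>j=1..K. x j - y j) = (x i - y i) + (\<Sum>j\<in>{1..K}-{i}. x j - y j)"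
      using i by (simp add: sum.remove)
    finally have "int (p i) dvd (x i - y i) + (\<Sum>j\<in>{1..K}-{i}. x j - y j)" .
    moreover have "int (p i) dvd (\<Sum>j\<in>{1..K}-{i}. x j - y j)"
    proof (rule dvd_sum)
      fix j assume j: "j \<in> {1..K} - {i}"
      have "p i dvd n div p j"
        using quot[of j] i j by (auto intro: dvd_prodI)
      hence "int (p i) dvd int (n div p j)" by simp
      moreover have "int (n div p j) dvd x j - y j"
        using mem[of j] j by (auto simp: Zsub_def)
      ultimately show "int (p i) dvd x j - y j" by (rule dvd_trans)
    qed
    ultimately have 1: "int (p i) dvd x i - y i"
      using dvd_add_left_iff by blast
    have 2: "int c dvd x i - y i"
      using mem[OF i] by (auto simp: Zsub_def c_def)
    have "coprime c (p i)"
    proof (rule coprimeI)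
      fix g assume "g dvd c" "g dvd p i"
      hence "g\<^sup>2 dvd n" by (simp add: nc power2_eq_square mult_dvd_mono)
      thus "is_unit g" using assms(1) squarefreeD by blast
    qed
    hence "int c * int (p i) dvd x i - y i"
      using 1 2 by (intro divides_mult) auto
    hence "int n dvd x i - y i" by (simp add: nc)
    moreover have "x i \<in> Zn n" "y i \<in> Zn n" using mem[OF i] by (auto simp: Zsub_def)
    ultimately show "x i = y i"
      using n0 by (simp add: mem_Zn mod_eq_dvd_iff[symmetric])
  qed
  have "card (Zprod n K p) = (\<Prod>j=1..K. card (Zsub n (p j)))"
    by (simp add: card_PiE)
  also have "\<dots> = (\<Prod>j=1..K. p j)"
    by (rule prod.cong) (use n0 dvdn card_Zsub in auto)
  also have "\<dots> = n" by (rule assms(3)[symmetric])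
  also have "n = card (Zn n)"
    using n0 by (simp add: carrier_integer_mod_group)
  finally have "card (Zprod n K p) = card (Zn n)" .
  moreover have "finite (Zn n)" using n0 by (simp add: carrier_integer_mod_group)
  moreover have "Zjoin n K ` Zprod n K p \<subseteq> Zn n"
    using n0 by (auto simp: Zjoin_def mem_Zn)
  ultimately show ?thesis
    using inj by (simp add: bij_betw_def card_image card_subset_eq)
qed

lemma Zjoin_iso:
  assumes "squarefree n" "\<forall>j\<in>{1..K}. prime (p j)" "n = (\<Prod>j=1..K. p j)"
  shows "Zjoin n K \<in> iso (product_group {1..K} (\<lambda>j. integer_mod_group n\<lparr>carrier := Zsub n (p j)\<rparr>))
                          (integer_mod_group n)"
proof -
  have "Zjoin n K \<in> Zprod n K p \<rightarrow> Zn n"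
    using bij_betw_Zjoin[OF assms] by (auto simp: bij_betw_def)
  moreover have "Zjoin n K (\<lambda>j\<in>{1..K}. (x j + y j) mod int n) = (Zjoin n K x + Zjoin n K y) mod int n"
    for x y :: "nat \<Rightarrow> int"
    by (simp add: Zjoin_def mod_sum_eq mod_add_eq sum.distrib)
  ultimately show ?thesis
    using bij_betw_Zjoin[OF assms]
    by (auto simp: iso_def hom_def mult_integer_mod_group)
qed

text \<open>As required by \<^const>\<open>permutes\<close>, a product permutation is the identity outside \<open>Z\<^sub>n\<close>.\<close>

definition prod_perm :: "nat \<Rightarrow> nat \<Rightarrow> (nat \<Rightarrow> nat) \<Rightarrow> (nat \<Rightarrow> int \<Rightarrow> int) \<Rightarrow> int \<Rightarrow> int" where
  "prod_perm n K p s k =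
     (if k \<in> Zn n
      then Zjoin n K (\<lambda>j\<in>{1..K}. s j (inv_into (Zprod n K p) (Zjoin n K) k j))
      else k)"

lemma prod_perm_Zjoin:
  assumes "squarefree n" "\<forall>j\<in>{1..K}. prime (p j)" "n = (\<Prod>j=1..K. p j)"
    and "x \<in> Zprod n K p"
  shows "prod_perm n K p s (Zjoin n K x) = Zjoin n K (\<lambda>j\<in>{1..K}. s j (x j))"
proof -
  note b = bij_betw_Zjoin[OF assms(1-3)]
  have "Zjoin n K x \<in> Zn n" using b assms(4) by (auto simp: bij_betw_def)
  moreover have "inv_into (Zprod n K p) (Zjoin n K) (Zjoin n K x) = x"
    using b assms(4) by (simp add: bij_betw_def)
  ultimately show ?thesis by (simp add: prod_perm_def)
qed

lemma prod_perm_permutes: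
  assumes "squarefree n" "\<forall>j\<in>{1..K}. prime (p j)" "n = (\<Prod>j=1..K. p j)"
    and s: "\<forall>j\<in>{1..K}. s j permutes Zsub n (p j)"
  shows "prod_perm n K p s permutes Zn n"
proof -
  note b = bij_betw_Zjoin[OF assms(1-3)]
  let ?h = "\<lambda>x. \<lambda>j\<in>{1..K}. s j (x j)"
  have m: "?h x \<in> Zprod n K p" if "x \<in> Zprod n K p" for x
    using that s by (auto simp: permutes_in_image PiE_iff)
  have inj: "inj_on (prod_perm n K p s) (Zn n)"
  proof (rule inj_onI)
    fix k l assume kl: "k \<in> Zn n" "l \<in> Zn n" and eq: "prod_perm n K p s k = prod_perm n K p s l"
    have surj: "Zn n = Zjoin n K ` Zprod n K p" using b by (simp add: bij_betw_def)
    obtain x where x: "x \<in> Zprod n K p" "k = Zjoin n K x"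
      using kl(1) unfolding surj by (rule imageE)
    obtain y where y: "y \<in> Zprod n K p" "l = Zjoin n K y"
      using kl(2) unfolding surj by (rule imageE)
    have "Zjoin n K (?h x) = Zjoin n K (?h y)"
      using eq x y prod_perm_Zjoin[OF assms(1-3)] by simp
    hence h: "?h x = ?h y"
      using inj_onD[OF bij_betw_imp_inj_on[OF b] _ m[OF x(1)] m[OF y(1)]] by blast
    have "x j = y j" if "j \<in> {1..K}" for j
    proof -
      have "s j (x j) = s j (y j)" using fun_cong[OF h, of j] that by simp
      thus ?thesis using s that by (meson injD permutes_inj)
    qed
    hence "x = y" using x(1) y(1) by (blast intro: PiE_ext)
    thus "k = l" using x y by simp
  qed
  have n0: "n > 0" using assms(1) by (auto intro!: Nat.gr0I)
  have sub: "prod_perm n K p s ` Zn n \<subseteq> Zn n"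
    using n0 by (auto simp: prod_perm_def Zjoin_def mem_Zn)
  have "finite (Zn n)" using n0 by (simp add: carrier_integer_mod_group)
  hence "bij_betw (prod_perm n K p s) (Zn n) (Zn n)"
    using inj sub by (simp add: bij_betw_def endo_inj_surj)
  thus ?thesis
    by (rule bij_imp_permutes) (simp add: prod_perm_def)
qed

end

theory Submission
  imports
    Defs
    "HOL-Number_Theory.Residues"
    "HOL-Computational_Algebra.Polynomial"
begin

text \<open>Both kinds of independence depend only on the integer relations between the n-th roots of unity, and
  these are governed by one fact. Fix a prime q dividing n and group the terms of a vanishing sum
  according to their q-coordinate. After dividing by the q-th roots of unity in front, every group is
  an element of the cyclotomic field of order n div q, and these q elements are all equal
  (\<open>slice_constant\<close>). The reason is the irreducibility of cyclotomic polynomials, used in the form that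
  a polynomial with integer coefficients vanishing at an n-th root of unity z also vanishes at z^t for
  every t prime to n (\<open>int_eval_power_coprime\<close>).

  Hence permuting the values of one coordinate turns relations into relations, and so does any product
  of such permutations (\<open>vanishing_sum_permute_coords\<close>), which is part (1).

  For part (2), call a coset of the subgroup of order q a q-line. Lines are minimal dependent sets, or
  circuits. Conversely, a circuit with q elements either is a q-line, or all its points agree in every
  coordinate belonging to a prime at least q (\<open>circuit_small\<close>); this is where n has to be odd. A
  permutation preserving the class maps circuits to circuits, so by induction on q it and its inverse
  preserve q-lines (\<open>permutation_preserves_lines\<close>). A permutation that maps lines in each direction to
  lines in the same direction is a product: points with the same q-coordinate are joined by a path
  of lines in the other directions, so their images have the same q-coordinate
  (\<open>permutation_preserves_coords\<close>). The argument works for every set of admissible coefficients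
  that contains 0 and 1, and so serves both classes.\<close>

section \<open>Conjugates of roots of unity\<close>

definition int_eval :: "int poly \<Rightarrow> 'a::comm_ring_1 \<Rightarrow> 'a" where
  "int_eval f z = poly (map_poly of_int f) z"

lemma int_eval_0 [simp]: "int_eval 0 z = 0"
  by (simp add: int_eval_def)

lemma int_eval_pCons [simp]: "int_eval (pCons a f) z = of_int a + z * int_eval f z"
  by (simp add: int_eval_def map_poly_pCons)

lemma int_eval_1 [simp]: "int_eval 1 z = 1"
  by (simp add: one_pCons)

lemma int_eval_add [simp]: "int_eval (f + g) z = int_eval f z + int_eval g z"
proof (induction f arbitrary: g)
  case (pCons a f)
  show ?case using pCons.IH by (cases g) (simp add: algebra_simps)
qed simp

lemma int_eval_smult [simp]: "int_eval (smult a f) z = of_int a * int_eval f z"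
  by (induction f) (auto simp: algebra_simps)

lemma int_eval_uminus [simp]: "int_eval (- f) z = - int_eval f z"
  by (induction f) (auto simp: algebra_simps)

lemma int_eval_diff [simp]: "int_eval (f - g) z = int_eval f z - int_eval g z"
  using int_eval_add[of f "- g" z] by simp

lemma int_eval_mult [simp]: "int_eval (f * g) z = int_eval f z * int_eval g z"
  by (induction f) (auto simp: algebra_simps)

lemma int_eval_power [simp]: "int_eval (f ^ k) z = int_eval f z ^ k"
  by (induction k) auto

lemma int_eval_sum: "int_eval (\<Sum>i\<in>I. f i) z = (\<Sum>i\<in>I. int_eval (f i) z)"
  by (induction I rule: infinite_finite_induct) auto

lemma int_eval_monom [simp]: "int_eval (monom a k) z = of_int a * z ^ k"
  by (simp add: int_eval_def map_poly_monom poly_monom)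

lemma int_eval_pcompose: "int_eval (pcompose f g) z = int_eval f (int_eval g z)"
  by (induction f) (auto simp: pcompose_pCons)

text \<open>The rings in use (\<int> and \<int>[X]) have characteristic 0, so the Frobenius identity is needed
  as a divisibility by q instead of an equation.\<close>

lemma dvd_add_power_diff:
  fixes a b :: "'a::comm_ring_1"
  assumes "prime q"
  shows "of_nat q dvd (a + b) ^ q - a ^ q - b ^ q"
proof -
  have q0: "q > 0" using assms prime_gt_0_nat by blast
  have "(a + b) ^ q = (\<Sum>k\<le>q. of_nat (q choose k) * a ^ k * b ^ (q - k))"
    by (rule binomial_ring)
  also have "{..q} = insert 0 (insert q {1..<q})" using q0 by auto
  also have "(\<Sum>k\<in>\<dots>. of_nat (q choose k) * a ^ k * b ^ (q - k)) =
      b ^ q + (a ^ q + (\<Sum>k\<in>{1..<q}. of_nat (q choose k) * a ^ k * b ^ (q - k)))"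
    using q0 by simp
  finally have "(a + b) ^ q - a ^ q - b ^ q =
      (\<Sum>k\<in>{1..<q}. of_nat (q choose k) * a ^ k * b ^ (q - k))" by simp
  also have "of_nat q dvd \<dots>"
  proof (rule dvd_sum)
    fix k assume "k \<in> {1..<q}"
    hence "q dvd (q choose k)" using assms by (intro dvd_choose_prime) auto
    thus "of_nat q dvd of_nat (q choose k) * a ^ k * b ^ (q - k)"
      by (metis dvd_def dvd_mult2 of_nat_mult)
  qed
  finally show ?thesis .
qed

lemma int_dvd_power_prime_diff:
  fixes a :: int
  assumes "prime q"
  shows "int q dvd a ^ q - a"
proof -
  define b where "b = nat (a mod int q)"
  have q0: "q > 0" using assms prime_gt_0_nat by blast
  have ab: "[a = int b] (mod int q)" using q0 by (simp add: b_def cong_def)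
  have "[b ^ q = b] (mod q)"
  proof (cases "q dvd b")
    case True
    thus ?thesis using q0 by (simp add: cong_def mod_eq_0_iff_dvd dvd_trans[OF _ dvd_power])
  next
    case False
    have "[b * b ^ (q - 1) = b * 1] (mod q)"
      by (intro cong_mult cong_refl fermat_theorem assms False)
    thus ?thesis using q0 by (metis mult.right_neutral power_eq_if not_gr_zero)
  qed
  hence "[int b ^ q = int b] (mod int q)" by (metis cong_int_iff of_nat_power)
  hence "[a ^ q = a] (mod int q)" using ab by (meson cong_pow cong_sym cong_trans)
  thus ?thesis by (simp add: cong_iff_dvd_diff)
qed

lemma frobenius_int_poly:
  assumes "prime q"
  shows "[:int q:] dvd pcompose f (monom 1 q) - f ^ q"
proof (induction f)
  case 0
  show ?case using prime_gt_0_nat[OF assms] by (simp add: power_0_left)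
next
  case (pCons a f)
  have X: "pCons a f = [:a:] + [:0,1:] * f" by simp
  have qq: "[:int q:] = of_nat q" by (simp add: of_nat_poly)
  have 1: "[:int q:] dvd ([:a:] + [:0,1:] * f) ^ q - [:a:] ^ q - ([:0,1:] * f) ^ q"
    unfolding qq by (rule dvd_add_power_diff[OF assms])
  have 2: "[:int q:] dvd [:a:] ^ q - [:a:]"
    using int_dvd_power_prime_diff[OF assms, of a]
    by (simp add: poly_const_pow)
  have 3: "[:int q:] dvd monom 1 q * (pcompose f (monom 1 q) - f ^ q)"
    using pCons.IH by (rule dvd_mult)
  have m: "([:0,1:] * f) ^ q = monom 1 q * f ^ q"
    by (simp only: power_mult_distrib monom_altdef) simp
  have "pcompose (pCons a f) (monom 1 q) - pCons a f ^ q =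
     monom 1 q * (pcompose f (monom 1 q) - f ^ q)
     - (([:a:] + [:0,1:] * f) ^ q - [:a:] ^ q - ([:0,1:] * f) ^ q) - ([:a:] ^ q - [:a:])"
    unfolding X[symmetric] m pcompose_pCons by (simp only: algebra_simps diff_add_cancel) simp?
  thus ?case using dvd_diff[OF dvd_diff[OF 3 1] 2] by (simp only:)
qed

text \<open>A polynomial h of least degree among those vanishing at z, made primitive, generates the ideal of
  all of them: pseudo-division by h leaves remainder 0 by minimality, which gives h dividing a
  constant multiple of g, and Gauss's lemma on contents removes the constant.\<close>

lemma minimal_int_poly:
  fixes z :: complex
  assumes "g0 \<noteq> 0" "int_eval g0 z = 0"
  obtains h where "h \<noteq> 0" "int_eval h z = 0" "\<And>g. int_eval g z = 0 \<Longrightarrow> h dvd g"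
proof -
  let ?P = "\<lambda>h. h \<noteq> 0 \<and> int_eval h z = 0"
  obtain h0 where h0: "?P h0" and min: "\<And>g. ?P g \<Longrightarrow> degree h0 \<le> degree g"
    using ex_has_least_nat[of ?P g0 degree] assms by blast
  define h where "h = primitive_part h0"
  have hh: "h0 = smult (content h0) h" by (simp add: h_def)
  have "int_eval h0 z = of_int (content h0) * int_eval h z"
    by (subst hh) (rule int_eval_smult)
  hence hz: "int_eval h z = 0" using h0 by simp
  have hP: "h \<noteq> 0" "content h = 1" "degree h = degree h0"
    using h0 by (auto simp: h_def)
  show ?thesis
  proof (rule that[OF hP(1) hz])
    fix g assume g: "int_eval g z = 0"
    obtain a q where aq: "a \<noteq> 0" "smult a g = h * q + pseudo_mod g h"
      using pseudo_mod(1)[OF hP(1)] by blast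
    have "int_eval (pseudo_mod g h) z = 0"
      using arg_cong[OF aq(2), of "\<lambda>f. int_eval f z"] g hz by simp
    hence "pseudo_mod g h = 0"
      using pseudo_mod(2)[OF hP(1), of g] min[of "pseudo_mod g h"] hP(3) by force
    hence e: "smult a g = h * q" using aq by simp
    have "normalize a * content g = content q"
      using arg_cong[OF e, of content] hP(2) by (simp add: content_mult)
    hence "a dvd content q" by (metis dvd_triv_left normalize_dvd_iff)
    hence "[:a:] dvd q" by (simp add: const_poly_dvd_iff_dvd_content)
    then obtain q' where "q = smult a q'" by (auto elim!: dvdE)
    hence "smult a g = smult a (h * q')" using e by simp
    hence "g = h * q'" using aq(1) by (metis smult_cancel)
    thus "h dvd g" by simp
  qed
qed

text \<open>Modulo q, a product whose one factor h has a unit as leading coefficient and positive degree is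
  either 0 or nonconstant. So if it is congruent to a constant, that constant is 0 modulo q. This
  replaces the statement that a rational number in \<int>[z], for a root z of h, is an integer.\<close>

lemma prime_dvd_const_mod_nonconst:
  fixes h :: "int poly"
  assumes q: "prime q" and lc: "is_unit (lead_coeff h)" and d: "degree h > 0"
    and dvd: "[:int q:] dvd [:a:] - h * g"
  shows "int q dvd a"
proof (rule ccontr)
  assume na: "\<not> int q dvd a"
  have pq: "prime (int q)" using q by simp
  have co: "int q dvd coeff ([:a:] - h * g) i" for i
    using dvd by (metis const_poly_dvd_iff)
  define S where "S = {i. \<not> int q dvd coeff g i}"
  have "S \<subseteq> {..degree g}" by (auto simp: S_def intro!: le_degree)
  hence fin: "finite S" using finite_subset by blast
  show False
  proof (cases "S = {}")
    case True
    hence "\<forall>i. int q dvd coeff g i" by (auto simp: S_def)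
    hence "[:int q:] dvd h * g" by (intro dvd_mult) (simp add: const_poly_dvd_iff)
    hence "[:int q:] dvd [:a:]" using dvd by (metis dvd_diff_left_iff)
    thus False using na by simp
  next
    case False
    define k where "k = Max S"
    have kS: "\<not> int q dvd coeff g k" using Max_in[OF fin False] by (simp add: S_def k_def)
    have above: "int q dvd coeff g i" if "i > k" for i
      using that Max_ge[OF fin, of i] by (force simp: S_def k_def)
    let ?d = "degree h"
    have "coeff (h * g) (?d + k) = (\<Sum>i\<le>?d + k. coeff h i * coeff g (?d + k - i))"
      by (rule coeff_mult)
    also have "\<dots> = lead_coeff h * coeff g k +
        (\<Sum>i\<in>{..?d + k} - {?d}. coeff h i * coeff g (?d + k - i))"
      by (subst sum.remove[of _ ?d]) auto
    finally have e: "coeff (h * g) (?d + k) = \<dots>" .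
    have "int q dvd (\<Sum>i\<in>{..?d + k} - {?d}. coeff h i * coeff g (?d + k - i))"
    proof (rule dvd_sum)
      fix i assume i: "i \<in> {..?d + k} - {?d}"
      show "int q dvd coeff h i * coeff g (?d + k - i)"
      proof (cases "i < ?d")
        case True thus ?thesis by (intro dvd_mult above) auto
      next
        case False
        hence "coeff h i = 0" using i by (intro coeff_eq_0) auto
        thus ?thesis by simp
      qed
    qed
    moreover have "int q dvd coeff (h * g) (?d + k)"
      using co[of "?d + k"] d by (simp add: coeff_pCons split: nat.splits)
    ultimately have "int q dvd lead_coeff h * coeff g k"
      unfolding e by (simp add: dvd_add_left_iff)
    hence "int q dvd coeff g k"
      using lc by (metis dvd_mult_unit_iff mult.commute)
    thus False using kS by simp
  qed
qed

text \<open>Let h be the minimal polynomial of z, and write X^n - 1 = h g. By Frobenius, h(z^q) lies in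
  q \<int>[z]. If it were nonzero, then g(z^q) = 0, and the derivative of h g at z^q would be
  h(z^q) g'(z^q). As the derivative of X^n - 1 at z^q is n times a unit, n would lie in
  q \<int>[z], which forces q to divide n. Working with the derivative avoids reducing polynomials
  modulo q and speaking of separability.\<close>

lemma int_eval_power_prime:
  fixes z :: complex
  assumes z: "z ^ n = 1" and n: "n > 0" and q: "prime q" and qn: "\<not> q dvd n"
    and f: "int_eval f z = 0"
  shows "int_eval f (z ^ q) = 0"
proof -
  define c :: "int poly" where "c = monom 1 n - 1"
  have c0: "c \<noteq> 0"
  proof
    assume "c = 0"
    hence "coeff c n = 0" by simp
    thus False using n by (simp add: c_def coeff_1)
  qed
  have "(z ^ q) ^ n = (z ^ n) ^ q" by (simp add: mult.commute flip: power_mult)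
  hence zq: "(z ^ q) ^ n = 1" using z by simp
  have cz: "int_eval c z = 0" "int_eval c (z ^ q) = 0"
    using z zq by (simp_all add: c_def)
  obtain h where h: "h \<noteq> 0" "int_eval h z = 0" and hmin: "\<And>g. int_eval g z = 0 \<Longrightarrow> h dvd g"
    using minimal_int_poly[OF c0 cz(1)] by blast
  obtain g where g: "c = h * g" using hmin[OF cz(1)] by (auto elim: dvdE)
  \<comment> \<open>h divides a monic polynomial, so it has a unit as leading coefficient\<close>
  have "lead_coeff c = 1"
  proof -
    have "degree c = n"
      using degree_add_eq_left[of "- 1" "monom 1 n :: int poly"] n
      by (simp add: c_def degree_monom_eq)
    thus ?thesis using n by (simp add: c_def coeff_1)
  qed
  hence "lead_coeff h * lead_coeff g = 1" by (simp add: g lead_coeff_mult)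
  hence lc: "is_unit (lead_coeff h)" by (metis dvd_triv_left)
  have dh: "degree h > 0"
  proof (rule ccontr)
    assume "\<not> degree h > 0"
    then obtain a where "h = [:a:]" by (metis degree_eq_zeroE neq0_conv)
    thus False using h by simp
  qed
  obtain b where "pcompose h (monom 1 q) - h ^ q = [:int q:] * b"
    using frobenius_int_poly[OF q, of h] by (auto elim: dvdE)
  from arg_cong[OF this, of "\<lambda>f. int_eval f z"]
  have hb: "int_eval h (z ^ q) = of_nat q * int_eval b z"
    using h(2) prime_gt_0_nat[OF q] by (simp add: int_eval_pcompose power_0_left)
  have "int_eval h (z ^ q) = 0"
  proof (rule ccontr)
    assume nz: "int_eval h (z ^ q) \<noteq> 0"
    have gz: "int_eval g (z ^ q) = 0" using nz cz(2) by (simp add: g)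
    \<comment> \<open>the derivative of c = h g at z^q, where g vanishes\<close>
    have "pderiv c = monom (int n) (n - 1)" by (simp add: c_def pderiv_diff pderiv_monom)
    hence "monom (int n) (n - 1) = h * pderiv g + pderiv h * g"
      by (simp add: g pderiv_mult mult.commute)
    from arg_cong[OF this, of "\<lambda>f. int_eval f (z ^ q)"]
    have e: "of_nat n * (z ^ q) ^ (n - 1) = of_nat q * int_eval b z * int_eval (pderiv g) (z ^ q)"
      by (simp add: gz hb)
    have "(z ^ q) ^ (n - 1) * z ^ q = 1"
      using n zq by (metis power_Suc2 Suc_diff_1)
    hence "of_nat n = of_nat n * (z ^ q) ^ (n - 1) * z ^ q" by simp
    also have "\<dots> = of_nat q * int_eval (b * pcompose (pderiv g) (monom 1 q) * monom 1 q) z"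
      unfolding e by (simp add: int_eval_pcompose)
    finally have "int_eval ([:int n:] - smult (int q) (b * pcompose (pderiv g) (monom 1 q) * monom 1 q)) z = 0"
      by simp
    from hmin[OF this] obtain k where
      k: "[:int n:] - smult (int q) (b * pcompose (pderiv g) (monom 1 q) * monom 1 q) = h * k"
      by (auto elim: dvdE)
    hence "[:int n:] - h * k = [:int q:] * (b * pcompose (pderiv g) (monom 1 q) * monom 1 q)"
      by (simp add: algebra_simps)
    hence "int q dvd int n"
      by (intro prime_dvd_const_mod_nonconst[OF q lc dh, where g = k]) (simp only: dvd_triv_left)
    thus False using qn by simp
  qed
  moreover have "h dvd f" using hmin f .
  ultimately show ?thesis by (auto elim!: dvdE)
qed

text \<open>Raising to a power prime to n is a composition of steps raising to a prime q not dividing n, and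
  every intermediate value is an n-th root of unity again.\<close>

lemma int_eval_power_coprime:
  fixes z :: complex
  assumes z: "z ^ n = 1" and n: "n > 0" and t: "coprime t n" and f: "int_eval f z = 0"
  shows "int_eval f (z ^ t) = 0"
proof (cases "n = 1")
  case True
  thus ?thesis using z f by simp
next
  case False
  hence "t > 0" using t by (auto intro!: Nat.gr0I)
  thus ?thesis using t
  proof (induction t rule: prime_divisors_induct)
    case (factor q t)
    have "coprime t n" "coprime q n" using factor.prems by auto
    hence "int_eval f (z ^ t) = 0" "\<not> q dvd n"
      using factor False by (auto dest: coprime_common_divisor)
    moreover have "(z ^ t) ^ n = 1" using z by (metis mult.commute power_mult power_one)
    ultimately have "int_eval f ((z ^ t) ^ q) = 0"
      using int_eval_power_prime n factor.hyps by blast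
    thus ?case by (simp add: mult.commute flip: power_mult)
  qed (use f in auto)
qed

section \<open>The roots of unity as a character of the integers\<close>

lemma root_of_unity_eq_cis: "root_of_unity n k = cis (2 * pi * (of_int k / of_nat n))"
  by (simp add: root_of_unity_def cis_conv_exp mult_ac)

lemma root_of_unity_add: "root_of_unity n (k + l) = root_of_unity n k * root_of_unity n l"
  by (simp add: root_of_unity_eq_cis cis_mult algebra_simps add_divide_distrib)

lemma root_of_unity_0 [simp]: "root_of_unity n 0 = 1"
  by (simp add: root_of_unity_eq_cis)

lemma root_of_unity_power: "root_of_unity n k ^ t = root_of_unity n (int t * k)"
  by (induction t) (auto simp: root_of_unity_add algebra_simps)

lemma root_of_unity_nonzero [simp]: "root_of_unity n k \<noteq> 0"
  by (simp add: root_of_unity_eq_cis)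

lemma root_of_unity_multiple:
  assumes "n > 0" "int n dvd k"
  shows "root_of_unity n k = 1"
proof -
  obtain j where "k = int n * j" using assms(2) by (auto elim: dvdE)
  hence "root_of_unity n k = cis (2 * pi * of_int j)"
    using assms(1) by (simp add: root_of_unity_eq_cis)
  thus ?thesis by (simp only: cis_multiple_2pi Ints_of_int)
qed

lemma root_of_unity_cong:
  assumes "n > 0" "[k = l] (mod int n)"
  shows "root_of_unity n k = root_of_unity n l"
  using root_of_unity_add[of n "k - l" l] root_of_unity_multiple[of n "k - l"] assms
  by (simp add: cong_iff_dvd_diff)

lemma root_of_unity_eq_iff:
  assumes "n > 0"
  shows "root_of_unity n k = root_of_unity n l \<longleftrightarrow> [k = l] (mod int n)"
proof
  assume eq: "root_of_unity n k = root_of_unity n l"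
  have m: "root_of_unity n j = root_of_unity n (j mod int n)" for j
    by (rule root_of_unity_cong[OF assms]) (simp add: cong_def)
  have "inj_on (root_of_unity n) (Zn n)"
    using bij_betw_root_of_unity[OF assms] by (rule bij_betw_imp_inj_on)
  moreover have "k mod int n \<in> Zn n" "l mod int n \<in> Zn n" using assms by (auto simp: mem_Zn)
  ultimately show "[k = l] (mod int n)"
    using eq m unfolding cong_def by (metis inj_onD)
qed (rule root_of_unity_cong[OF assms])

text \<open>Exponents are reduced modulo n, so the sum is the value at a root of unity of a polynomial with
  integer coefficients.\<close>

lemma vanishing_sum_conjugate:
  assumes n: "n > 0" and t: "coprime t n"
    and rel: "(\<Sum>i\<in>I. of_int (c i) * root_of_unity n (u i)) = 0"
  shows "(\<Sum>i\<in>I. of_int (c i) * root_of_unity n (int t * u i)) = 0"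
proof -
  let ?w = "root_of_unity n 1"
  define f :: "int poly" where "f = (\<Sum>i\<in>I. monom (c i) (nat (u i mod int n)))"
  have u: "?w ^ nat (u i mod int n) = root_of_unity n (u i)" for i
    using n by (auto simp: root_of_unity_power cong_def intro!: root_of_unity_cong)
  have w1: "?w ^ n = 1" using n by (simp add: root_of_unity_power root_of_unity_multiple)
  have "int_eval f ?w = 0"
    using rel by (simp add: f_def int_eval_sum u)
  from int_eval_power_coprime[OF w1 n t this]
  have "int_eval f (?w ^ t) = 0" .
  moreover have "(?w ^ t) ^ nat (u i mod int n) = root_of_unity n (int t * u i)" for i
    by (metis u mult.commute power_mult root_of_unity_power)
  ultimately show ?thesis by (simp add: f_def int_eval_sum)
qed

section \<open>Coordinates modulo a square-free number\<close>

text \<open>For square-free n and a prime q dividing n, the numbers q and n div q are coprime. So Z_n is the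
  product of its subgroup of order q with the subgroup of multiples of q, and two elements have the
  same q-coordinate if and only if they are congruent modulo q; they differ in the q-coordinate only
  if and only if they are congruent modulo n div q. All later arguments use these congruences.\<close>

locale squarefree_modulus =
  fixes n :: nat
  assumes sqf: "squarefree n"
begin

abbreviation R :: "int \<Rightarrow> complex" where "R \<equiv> root_of_unity n"

lemma n_pos: "n > 0"
  using sqf by (auto intro!: Nat.gr0I)

lemma finite_Zn: "finite (Zn n)"
  using n_pos by (simp add: carrier_integer_mod_group)

lemma finite_Zsub [simp]: "finite (Zsub n d)"
  using finite_Zn by (simp add: Zsub_def)

lemma Zn_cong_imp_eq:
  assumes "k \<in> Zn n" "l \<in> Zn n" "[k = l] (mod int n)"
  shows "k = l"
  using assms n_pos by (simp add: mem_Zn cong_def)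

lemma prime_quotient:
  assumes "prime q" "q dvd n"
  shows "coprime (n div q) q" "n div q * q = n"
proof -
  show e: "n div q * q = n" using assms by simp
  show "coprime (n div q) q"
  proof (rule coprimeI)
    fix g assume "g dvd n div q" "g dvd q"
    hence "g ^ 2 dvd n div q * q" by (simp add: power2_eq_square mult_dvd_mono)
    thus "is_unit g" using sqf squarefreeD unfolding e by blast
  qed
qed

lemma cong_quotientD:
  assumes "prime q" "q dvd n" "prime r" "r dvd n" "r \<noteq> q" "[a = b] (mod int (n div q))"
  shows "[a = b] (mod int r)"
proof -
  have "r dvd n div q * q" using assms prime_quotient by metis
  hence "r dvd n div q" using assms by (metis prime_dvd_mult_iff primes_dvd_imp_eq)
  thus ?thesis using assms(6) cong_dvd_modulus by (metis int_dvd_int_iff)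
qed

text \<open>This uses that n is square-free; together with the Chinese remainder theorem it is the
  decomposition of Z_n into coordinates.\<close>

lemma cong_modI:
  assumes "\<And>q. prime q \<Longrightarrow> q dvd n \<Longrightarrow> [a = b] (mod int q)"
  shows "[a = b] (mod int n)"
proof (cases "a = b")
  case False
  define y where "y = nat \<bar>a - b\<bar>"
  have "int y = \<bar>a - b\<bar>" by (simp add: y_def)
  hence d: "[a = b] (mod int k) \<longleftrightarrow> k dvd y" for k
    by (metis cong_iff_dvd_diff dvd_abs_iff int_dvd_int_iff)
  have "n dvd y"
  proof (rule multiplicity_le_imp_dvd)
    show "n \<noteq> 0" using n_pos by simp
    fix q :: nat assume q: "prime q"
    show "multiplicity q n \<le> multiplicity q y"
    proof (cases "q dvd n")
      case True
      have "multiplicity q n \<le> 1"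
        using sqf q n_pos by (simp add: squarefree_factorial_semiring'' prime_imp_prime_elem)
      moreover have "multiplicity q y \<ge> 1"
        using assms[OF q True] False q
        by (intro multiplicity_geI) (auto simp: d y_def)
      ultimately show ?thesis by simp
    qed (simp add: not_dvd_imp_multiplicity_0)
  qed
  thus ?thesis by (simp add: d)
qed simp

lemma cong_mod_quotientI:
  assumes "prime q" "q dvd n" "[a = b] (mod int q)" "[a = b] (mod int (n div q))"
  shows "[a = b] (mod int n)"
  using cong_quotientD[OF assms(1,2) _ _ _ assms(4)] assms(3) by (intro cong_modI) metis

lemma chinese_remainder_Zn:
  assumes "prime q" "q dvd n"
  obtains z where "z \<in> Zn n" "[z = a] (mod int (n div q))" "[z = b] (mod int q)"
proof -
  have "coprime (int (n div q)) (int q)" using prime_quotient[OF assms] by (simp only: coprime_int_iff)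
  then obtain z where z: "[z = a] (mod int (n div q))" "[z = b] (mod int q)"
    using binary_chinese_remainder_int by blast
  have dv: "int (n div q) dvd int n" "int q dvd int n"
    using prime_quotient(2)[OF assms] assms by (metis dvd_triv_left int_dvd_int_iff)+
  have "[z mod int n = z] (mod int n)" by (simp add: cong_def)
  hence "[z mod int n = z] (mod int (n div q))" "[z mod int n = z] (mod int q)"
    using dv cong_dvd_modulus by blast+
  moreover have "z mod int n \<in> Zn n" using n_pos by (simp add: mem_Zn)
  ultimately show ?thesis using that z cong_trans by blast
qed

text \<open>The q-coordinate is represented by an element of the subgroup of order q instead of a residue
  modulo q, because the factors of a product permutation act on that subgroup. The witness is unique
  (see \<open>coord_eqI\<close>).\<close>

definition coord :: "nat \<Rightarrow> int \<Rightarrow> int" where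
  "coord q k = (SOME x. x \<in> Zsub n q \<and> [x = k] (mod int q))"

lemma mem_Zsub_iff: "x \<in> Zsub n q \<longleftrightarrow> x \<in> Zn n \<and> [x = 0] (mod int (n div q))"
  by (simp add: Zsub_def cong_0_iff)

lemma coord:
  assumes "prime q" "q dvd n"
  shows "coord q k \<in> Zsub n q" "[coord q k = k] (mod int q)"
proof -
  obtain z where "z \<in> Zn n" "[z = 0] (mod int (n div q))" "[z = k] (mod int q)"
    using chinese_remainder_Zn[OF assms] .
  hence "\<exists>x. x \<in> Zsub n q \<and> [x = k] (mod int q)" by (auto simp: mem_Zsub_iff)
  from someI_ex[OF this] show "coord q k \<in> Zsub n q" "[coord q k = k] (mod int q)"
    by (auto simp: coord_def)
qed

lemma coord_eqI:
  assumes "prime q" "q dvd n" "x \<in> Zsub n q" "[x = k] (mod int q)"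
  shows "coord q k = x"
proof (rule Zn_cong_imp_eq)
  note c = coord[OF assms(1,2), of k]
  show "coord q k \<in> Zn n" "x \<in> Zn n" using c assms by (auto simp: mem_Zsub_iff)
  show "[coord q k = x] (mod int n)"
  proof (rule cong_mod_quotientI[OF assms(1,2)])
    show "[coord q k = x] (mod int q)" using c assms by (meson cong_sym cong_trans)
    show "[coord q k = x] (mod int (n div q))"
      using c assms by (meson cong_sym cong_trans mem_Zsub_iff)
  qed
qed

lemma coord_eq_iff:
  assumes "prime q" "q dvd n"
  shows "coord q k = coord q l \<longleftrightarrow> [k = l] (mod int q)"
  using coord[OF assms] coord_eqI[OF assms] by (metis cong_sym cong_trans)

lemma coord_Zsub:
  assumes "prime q" "q dvd n" "x \<in> Zsub n q"
  shows "coord q x = x"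
  using assms by (intro coord_eqI) auto

section \<open>Vanishing sums and permutations of coordinates\<close>

text \<open>Write a root of unity as R x * R (u - x), where x is the q-component of u and R (u - x) has order
  dividing n div q. A sum of roots of unity then becomes a sum of R x times coefficients in the
  cyclotomic field of order n div q; a slice is such a coefficient.\<close>

definition slice :: "nat \<Rightarrow> 'i set \<Rightarrow> ('i \<Rightarrow> int) \<Rightarrow> ('i \<Rightarrow> int) \<Rightarrow> int \<Rightarrow> complex" where
  "slice q I c u x = (\<Sum>i\<in>{i\<in>I. coord q (u i) = x}. of_int (c i) * R (u i - x))"

text \<open>The function \<open>\<phi>\<close> will be the identity, multiplication by an integer (Galois conjugation) and a
  permutation of the q-coordinate.\<close>

lemma sum_slices:
  assumes q: "prime q" "q dvd n" and fin: "finite I"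
  shows "(\<Sum>i\<in>I. of_int (c i) * R (\<phi> (coord q (u i)) + (u i - coord q (u i)))) =
         (\<Sum>x\<in>Zsub n q. R (\<phi> x) * slice q I c u x)"
proof -
  have "(\<Sum>i\<in>I. of_int (c i) * R (\<phi> (coord q (u i)) + (u i - coord q (u i)))) =
     (\<Sum>x\<in>Zsub n q. \<Sum>i\<in>{i\<in>I. coord q (u i) = x}.
        of_int (c i) * R (\<phi> (coord q (u i)) + (u i - coord q (u i))))"
    by (rule sum.group[symmetric]) (use q fin coord in auto)
  also have "\<dots> = (\<Sum>x\<in>Zsub n q. R (\<phi> x) * slice q I c u x)"
    unfolding slice_def sum_distrib_left
    by (intro sum.cong refl) (auto simp: root_of_unity_add[of n "\<phi> _"])
  finally show ?thesis .
qed

lemma sum_root_of_unity_powers: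
  assumes q: "prime q" "q dvd n" and xy: "x \<in> Zsub n q" "y \<in> Zsub n q"
  shows "(\<Sum>s<q. R (int s * (x - y))) = (if x = y then of_nat q else 0)"
proof (cases "x = y")
  case False
  have "\<not> [x - y = 0] (mod int n)"
    using False xy Zn_cong_imp_eq by (auto simp: mem_Zsub_iff cong_diff_iff_cong_0)
  hence ne: "R (x - y) \<noteq> 1" using root_of_unity_eq_iff[OF n_pos, of "x - y" 0] by simp
  have "int (n div q) dvd x - y" using xy by (auto simp: Zsub_def)
  hence "int (n div q) * int q dvd (x - y) * int q" by (rule mult_dvd_mono) simp
  hence "int n dvd int q * (x - y)"
    using prime_quotient(2)[OF q] by (metis mult.commute of_nat_mult)
  hence "R (x - y) ^ q = 1" by (simp add: root_of_unity_power root_of_unity_multiple n_pos)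
  moreover have "(\<Sum>s<q. R (int s * (x - y))) = (\<Sum>s<q. R (x - y) ^ s)"
    by (simp add: root_of_unity_power)
  ultimately show ?thesis using False ne by (simp add: geometric_sum)
qed simp

text \<open>The conjugation by an exponent congruent to 1 modulo n div q and to s modulo q fixes the slices and
  raises their factors R x to the power s.\<close>

lemma sum_twisted_slices:
  assumes q: "prime q" "q dvd n" and fin: "finite I"
    and rel: "(\<Sum>i\<in>I. of_int (c i) * R (u i)) = 0" and s: "0 < s" "s < q"
  shows "(\<Sum>x\<in>Zsub n q. R (int s * x) * slice q I c u x) = 0"
proof -
  obtain z where z: "z \<in> Zn n" "[z = 1] (mod int (n div q))" "[z = int s] (mod int q)"
    using chinese_remainder_Zn[OF q] .
  define t where "t = nat z"
  have zt: "z = int t" using z n_pos by (simp add: t_def mem_Zn)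
  have "coprime t n"
  proof -
    have "[t = 1] (mod n div q)" "[t = s] (mod q)"
      using z unfolding zt by (simp_all flip: cong_int_iff)
    hence "coprime t (n div q)" "coprime t q"
      using s q(1) by (metis cong_imp_coprime cong_sym coprime_1_left,
        metis cong_imp_coprime cong_sym coprime_commute nat_dvd_not_less prime_imp_coprime)
    thus ?thesis using prime_quotient(2)[OF q] by (metis coprime_mult_right_iff)
  qed
  from vanishing_sum_conjugate[OF n_pos this rel]
  have "(\<Sum>i\<in>I. of_int (c i) * R (z * u i)) = 0" by (simp add: zt)
  moreover have "R (z * u i) = R (int s * coord q (u i) + (u i - coord q (u i)))" for i
  proof (rule root_of_unity_cong[OF n_pos], rule cong_mod_quotientI[OF q])
    let ?x = "coord q (u i)"
    note x = coord[OF q, of "u i"]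
    have zx: "[z * u i = int s * ?x] (mod int q)"
      using x(2) z(3) by (intro cong_mult) (auto intro: cong_sym)
    have "[u i - ?x = 0] (mod int q)" using cong_sym[OF x(2)] by (simp add: cong_diff_iff_cong_0)
    from cong_add[OF zx cong_sym[OF this]]
    show "[z * u i = int s * ?x + (u i - ?x)] (mod int q)" by simp
    have x0: "[?x = 0] (mod int (n div q))" using x(1) by (simp add: mem_Zsub_iff)
    have "[z * u i = 1 * u i] (mod int (n div q))" using z(2) by (intro cong_mult) auto
    moreover have "[int s * ?x + (u i - ?x) = int s * 0 + (u i - 0)] (mod int (n div q))"
      using x0 by (intro cong_add cong_mult cong_diff) auto
    ultimately show "[z * u i = int s * ?x + (u i - ?x)] (mod int (n div q))"
      by (simp add: cong_def)
  qed
  ultimately show ?thesis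
    using sum_slices[OF q fin, of c "\<lambda>x. int s * x" u] by simp
qed

text \<open>The twisted sums say that the Fourier transform of the slices over the group of order q vanishes
  except at the trivial character, so Fourier inversion makes the slices constant. This is the
  irreducibility of the q-th cyclotomic polynomial over the cyclotomic field of order n div q.\<close>

lemma slice_constant:
  assumes q: "prime q" "q dvd n" and fin: "finite I"
    and rel: "(\<Sum>i\<in>I. of_int (c i) * R (u i)) = 0" and y: "y \<in> Zsub n q"
  shows "slice q I c u y = (\<Sum>x\<in>Zsub n q. slice q I c u x) / of_nat q"
proof -
  let ?V = "slice q I c u"
  have q0: "q > 0" using q prime_gt_0_nat by blast
  have "of_nat q * ?V y = (\<Sum>x\<in>Zsub n q. ?V x * (if x = y then of_nat q else 0))"
    using y by (simp add: sum.delta' mult.commute if_distrib cong: if_cong)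
  also have "\<dots> = (\<Sum>x\<in>Zsub n q. ?V x * (\<Sum>s<q. R (int s * (x - y))))"
    by (intro sum.cong refl) (simp add: sum_root_of_unity_powers[OF q _ y])
  also have "\<dots> = (\<Sum>s<q. \<Sum>x\<in>Zsub n q. ?V x * R (int s * (x - y)))"
    unfolding sum_distrib_left by (rule sum.swap)
  also have "\<dots> = (\<Sum>s<q. R (- (int s * y)) * (\<Sum>x\<in>Zsub n q. R (int s * x) * ?V x))"
  proof -
    have "R (int s * (x - y)) = R (- (int s * y)) * R (int s * x)" for s x
      by (simp add: right_diff_distrib flip: root_of_unity_add)
    thus ?thesis unfolding sum_distrib_left by (simp add: mult_ac)
  qed
  \<comment> \<open>only the trivial character survives\<close>
  also have "\<dots> = (\<Sum>s\<in>{0}. R (- (int s * y)) * (\<Sum>x\<in>Zsub n q. R (int s * x) * ?V x))"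
    using q0 sum_twisted_slices[OF q fin rel] by (intro sum.mono_neutral_right) auto
  also have "\<dots> = (\<Sum>x\<in>Zsub n q. ?V x)" by simp
  finally show ?thesis using q0 by (simp add: field_simps)
qed

lemma slice_eq:
  assumes "prime q" "q dvd n" "finite I" "(\<Sum>i\<in>I. of_int (c i) * R (u i)) = 0"
    "x \<in> Zsub n q" "y \<in> Zsub n q"
  shows "slice q I c u x = slice q I c u y"
  using slice_constant[OF assms(1-4)] assms(5,6) by metis

text \<open>Since the slices are equal, permuting the factors R x among them does not change the sum.\<close>

lemma vanishing_sum_permute_coord:
  assumes q: "prime q" "q dvd n" and fin: "finite I"
    and rel: "(\<Sum>i\<in>I. of_int (c i) * R (u i)) = 0"
    and \<pi>: "\<pi> permutes Zsub n q"
    and u': "\<And>i. i \<in> I \<Longrightarrow> [u' i = u i] (mod int (n div q))"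
      "\<And>i. i \<in> I \<Longrightarrow> [u' i = \<pi> (coord q (u i))] (mod int q)"
  shows "(\<Sum>i\<in>I. of_int (c i) * R (u' i)) = 0"
proof -
  let ?V = "slice q I c u"
  have z: "0 \<in> Zsub n q" using n_pos by (simp add: Zsub_def mem_Zn)
  have V: "?V x = ?V 0" if "x \<in> Zsub n q" for x
    using slice_eq[OF q fin rel that z] .
  have "R (u' i) = R (\<pi> (coord q (u i)) + (u i - coord q (u i)))" if i: "i \<in> I" for i
  proof (rule root_of_unity_cong[OF n_pos], rule cong_mod_quotientI[OF q])
    let ?x = "coord q (u i)"
    note x = coord[OF q, of "u i"]
    have "[u i - ?x = 0] (mod int q)" using cong_sym[OF x(2)] by (simp add: cong_diff_iff_cong_0)
    from cong_add[OF u'(2)[OF i] cong_sym[OF this]]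
    show "[u' i = \<pi> ?x + (u i - ?x)] (mod int q)" by simp
    have "[\<pi> ?x + (u i - ?x) = 0 + (u i - 0)] (mod int (n div q))"
      using x(1) permutes_in_image[OF \<pi>, of ?x] by (intro cong_add cong_diff) (auto simp: mem_Zsub_iff)
    thus "[u' i = \<pi> ?x + (u i - ?x)] (mod int (n div q))"
      using u'(1)[OF i] by (simp add: cong_def)
  qed
  hence "(\<Sum>i\<in>I. of_int (c i) * R (u' i)) = (\<Sum>x\<in>Zsub n q. R (\<pi> x) * ?V x)"
    using sum_slices[OF q fin, of c \<pi> u] by simp
  also have "\<dots> = (\<Sum>x\<in>Zsub n q. R (\<pi> x)) * ?V 0"
    using V by (simp add: sum_distrib_right)
  also have "(\<Sum>x\<in>Zsub n q. R (\<pi> x)) = (\<Sum>x\<in>Zsub n q. R x)"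
    using sum.permute[OF \<pi>, of R] by (simp add: comp_def)
  also have "\<dots> * ?V 0 = (\<Sum>x\<in>Zsub n q. R x * ?V x)"
    using V by (simp add: sum_distrib_right)
  also have "\<dots> = 0"
    using sum_slices[OF q fin, of c "\<lambda>x. x" u] rel by simp
  finally show ?thesis .
qed

text \<open>The coordinates are permuted one prime at a time; the Chinese remainder theorem provides the
  intermediate exponents.\<close>

lemma vanishing_sum_permute_coords:
  assumes J: "finite J" "J \<subseteq> prime_factors n" and fin: "finite I"
    and rel: "(\<Sum>i\<in>I. of_int (c i) * R (u i)) = 0"
    and \<pi>: "\<And>q. q \<in> J \<Longrightarrow> \<pi> q permutes Zsub n q"
    and u'J: "\<And>i q. i \<in> I \<Longrightarrow> q \<in> J \<Longrightarrow> [u' i = \<pi> q (coord q (u i))] (mod int q)"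
    and u': "\<And>i q. i \<in> I \<Longrightarrow> q \<in> prime_factors n - J \<Longrightarrow> [u' i = u i] (mod int q)"
  shows "(\<Sum>i\<in>I. of_int (c i) * R (u' i)) = 0"
  using J \<pi> u'J u'
proof (induction J arbitrary: u' rule: finite_induct)
  case empty
  have "R (u' i) = R (u i)" if "i \<in> I" for i
    by (intro root_of_unity_cong n_pos cong_modI empty.prems) (use that n_pos in \<open>auto simp: prime_factors_dvd\<close>)
  thus ?case using rel by simp
next
  case (insert r J)
  have r: "prime r" "r dvd n" using insert.prems(1) by (auto simp: prime_factors_dvd)
  have "\<exists>z. [z = u' i] (mod int (n div r)) \<and> [z = u i] (mod int r)" for i
    using chinese_remainder_Zn[OF r] by metis
  then obtain u'' where u'': "\<And>i. [u'' i = u' i] (mod int (n div r))" "\<And>i. [u'' i = u i] (mod int r)"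
    by metis
  have ne: "[u'' i = u' i] (mod int q)" if "q \<in> prime_factors n" "q \<noteq> r" for i q
    by (rule cong_quotientD[OF r _ _ that(2) u''(1)]) (use that in \<open>auto simp: prime_factors_dvd\<close>)
  have "(\<Sum>i\<in>I. of_int (c i) * R (u'' i)) = 0"
  proof (rule insert.IH)
    show "J \<subseteq> prime_factors n" using insert.prems(1) by blast
    show "\<pi> q permutes Zsub n q" if "q \<in> J" for q using insert.prems(2) that by blast
    show "[u'' i = \<pi> q (coord q (u i))] (mod int q)" if "i \<in> I" "q \<in> J" for i q
    proof -
      have "q \<in> prime_factors n" "q \<noteq> r" using that insert.prems(1) insert.hyps(2) by auto
      thus ?thesis using ne insert.prems(3)[of i q] that by (blast intro: cong_trans)
    qed
    show "[u'' i = u i] (mod int q)" if "i \<in> I" "q \<in> prime_factors n - J" for i q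
      using insert.prems(4)[of i q] u''(2) ne[of q i] that
      by (cases "q = r") (auto intro: cong_trans)
  qed
  moreover have "coord r (u'' i) = coord r (u i)" for i
    using u''(2) by (simp add: coord_eq_iff[OF r])
  ultimately show ?case
    using vanishing_sum_permute_coord[OF r fin, where c = c and u = u'' and \<pi> = "\<pi> r" and u' = u'] insert.prems(2,3) cong_sym[OF u''(1)]
    by simp
qed

section \<open>Relation-free sets\<close>

text \<open>With U = {0, 1, -1} and U = UNIV this covers quasi-independence and independence at once.\<close>

definition relation_free :: "int set \<Rightarrow> int set \<Rightarrow> bool" where
  "relation_free U E \<longleftrightarrow>
     (\<forall>e. (\<forall>k\<in>E. e k \<in> U) \<and> (\<Sum>k\<in>E. of_int (e k) * R k) = 0 \<longrightarrow> (\<forall>k\<in>E. e k = 0))"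

lemma inj_on_R: "E \<subseteq> Zn n \<Longrightarrow> inj_on R E"
  using bij_betw_root_of_unity[OF n_pos] by (auto simp: bij_betw_def intro: inj_on_subset)

text \<open>A relation on a finite subset extends by zero coefficients to all of E, which is why U has to
  contain 0.\<close>

lemma relation_free_iff_image:
  assumes U: "0 \<in> U" and E: "E \<subseteq> Zn n"
  shows "relation_free U E \<longleftrightarrow>
    (\<forall>F e. finite F \<and> F \<subseteq> R ` E \<and> (\<forall>x\<in>F. e x \<in> U) \<and> (\<Sum>x\<in>F. zmult (e x) x) = 0
        \<longrightarrow> (\<forall>x\<in>F. e x = 0))" (is "_ \<longleftrightarrow> ?rhs")
proof
  note inj = inj_on_R[OF E]
  have fin: "finite E" using E finite_Zn finite_subset by blast
  show ?rhs if free: "relation_free U E"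
  proof (intro allI impI, elim conjE)
    fix F and e :: "complex \<Rightarrow> int"
    assume F: "finite F" "F \<subseteq> R ` E" "\<forall>x\<in>F. e x \<in> U" "(\<Sum>x\<in>F. zmult (e x) x) = 0"
    define d where "d k = (if R k \<in> F then e (R k) else 0)" for k
    have "(\<Sum>k\<in>E. of_int (d k) * R k) = (\<Sum>k\<in>{k\<in>E. R k \<in> F}. zmult (e (R k)) (R k))"
      using fin by (intro sum.mono_neutral_cong_right) (auto simp: d_def zmult_of_int)
    also have "\<dots> = (\<Sum>x\<in>R ` {k\<in>E. R k \<in> F}. zmult (e x) x)"
      by (rule sum.reindex_cong[symmetric, of R]) (auto intro: inj_on_subset[OF inj])
    also have "R ` {k\<in>E. R k \<in> F} = F" using F(2) by auto
    finally have "(\<Sum>k\<in>E. of_int (d k) * R k) = 0" using F(4) by simp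
    moreover have "\<forall>k\<in>E. d k \<in> U" using F(3) U by (auto simp: d_def)
    ultimately have "\<forall>k\<in>E. d k = 0" using free unfolding relation_free_def by blast
    thus "\<forall>x\<in>F. e x = 0" using F(2) by (auto simp: d_def split: if_splits)
  qed
  show "relation_free U E" if rhs: ?rhs
    unfolding relation_free_def
  proof (intro allI impI, elim conjE)
    fix e assume e: "\<forall>k\<in>E. e k \<in> U" "(\<Sum>k\<in>E. of_int (e k) * R k) = 0"
    define d where "d x = e (inv_into E R x)" for x
    have d: "d (R k) = e k" if "k \<in> E" for k using inj that by (simp add: d_def)
    have "(\<Sum>x\<in>R ` E. zmult (d x) x) = (\<Sum>k\<in>E. of_int (e k) * R k)"
      by (rule sum.reindex_cong[OF inj refl]) (simp add: d zmult_of_int)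
    hence "(\<Sum>x\<in>R ` E. zmult (d x) x) = 0" using e(2) by (rule trans)
    moreover have "\<forall>x\<in>R ` E. d x \<in> U" using e(1) d by auto
    ultimately have "\<forall>x\<in>R ` E. d x = 0"
      using rhs finite_imageI[OF fin] by blast
    thus "\<forall>k\<in>E. e k = 0" using d by auto
  qed
qed

lemma Zn_quasi_independent_iff:
  "E \<subseteq> Zn n \<Longrightarrow> Zn_quasi_independent n E \<longleftrightarrow> relation_free {0, 1, -1} E"
  by (subst relation_free_iff_image) (simp_all add: Zn_quasi_independent_def quasi_independent_def)

lemma Zn_independent_iff:
  assumes "E \<subseteq> Zn n"
  shows "Zn_independent n E \<longleftrightarrow> relation_free UNIV E"
proof -
  have *: "zmult a x = 0 \<longleftrightarrow> a = 0" if "x \<in> F" "F \<subseteq> R ` E" for a x F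
    using that by (auto simp: zmult_of_int)
  show ?thesis
    by (subst relation_free_iff_image)
      (use assms in \<open>auto simp: Zn_independent_def int_independent_def * cong: conj_cong\<close>)
qed

text \<open>Relations transfer in both directions, since the inverse permutations of the coordinates undo
  the given ones.\<close>

lemma relation_free_image_coords:
  assumes E: "E \<subseteq> Zn n" and inj: "inj_on \<sigma> E"
    and \<pi>: "\<And>q. q \<in> prime_factors n \<Longrightarrow> \<pi> q permutes Zsub n q"
    and \<sigma>: "\<And>k q. k \<in> E \<Longrightarrow> q \<in> prime_factors n \<Longrightarrow> [\<sigma> k = \<pi> q (coord q k)] (mod int q)"
  shows "relation_free U (\<sigma> ` E) \<longleftrightarrow> relation_free U E"
proof -
  have fin: "finite E" using E finite_Zn finite_subset by blast
  have reindex: "(\<Sum>k\<in>\<sigma> ` E. of_int (e k) * R k) = (\<Sum>k\<in>E. of_int (e (\<sigma> k)) * R (\<sigma> k))" for e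
    by (rule sum.reindex_cong[OF inj]) auto
  have 1: "(\<Sum>k\<in>E. of_int (e k) * R (\<sigma> k)) = 0" if "(\<Sum>k\<in>E. of_int (e k) * R k) = 0" for e
    using vanishing_sum_permute_coords[of "prime_factors n" E e "\<lambda>k. k" \<pi> \<sigma>] fin that \<pi> \<sigma> by simp
  have 2: "(\<Sum>k\<in>E. of_int (e k) * R k) = 0" if "(\<Sum>k\<in>E. of_int (e k) * R (\<sigma> k)) = 0" for e
  proof (rule vanishing_sum_permute_coords[of "prime_factors n" E e \<sigma> "\<lambda>q. inv_into UNIV (\<pi> q)" "\<lambda>k. k"])
    show "inv_into UNIV (\<pi> q) permutes Zsub n q" if "q \<in> prime_factors n" for q
      using \<pi>[OF that] by (rule permutes_inv)
    fix k q assume k: "k \<in> E" and q: "q \<in> prime_factors n"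
    have q': "prime q" "q dvd n" using q by (auto simp: prime_factors_dvd)
    have "coord q (\<sigma> k) = \<pi> q (coord q k)"
      using \<pi>[OF q] coord(1)[OF q'] \<sigma>[OF k q]
      by (intro coord_eqI[OF q']) (auto simp: permutes_in_image cong_sym)
    hence "inv_into UNIV (\<pi> q) (coord q (\<sigma> k)) = coord q k"
      using permutes_inverses(2)[OF \<pi>[OF q]] by simp
    thus "[k = inv_into UNIV (\<pi> q) (coord q (\<sigma> k))] (mod int q)"
      using coord(2)[OF q', of k] by (simp add: cong_sym)
  qed (use fin that in auto)
  show ?thesis
  proof
    assume free: "relation_free U (\<sigma> ` E)"
    show "relation_free U E"
      unfolding relation_free_def
    proof (intro allI impI, elim conjE)
      fix e assume e: "\<forall>k\<in>E. e k \<in> U" "(\<Sum>k\<in>E. of_int (e k) * R k) = 0"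
      define d where "d l = e (inv_into E \<sigma> l)" for l
      have d: "d (\<sigma> k) = e k" if "k \<in> E" for k using inj that by (simp add: d_def)
      have "(\<Sum>k\<in>\<sigma> ` E. of_int (d k) * R k) = 0" using 1[OF e(2)] by (simp add: reindex d)
      moreover have "\<forall>k\<in>\<sigma> ` E. d k \<in> U" using d e(1) by auto
      ultimately have "\<forall>k\<in>\<sigma> ` E. d k = 0" using free unfolding relation_free_def by blast
      thus "\<forall>k\<in>E. e k = 0" using d by auto
    qed
  next
    assume free: "relation_free U E"
    show "relation_free U (\<sigma> ` E)"
      unfolding relation_free_def
    proof (intro allI impI, elim conjE)
      fix e assume e: "\<forall>k\<in>\<sigma> ` E. e k \<in> U" "(\<Sum>k\<in>\<sigma> ` E. of_int (e k) * R k) = 0"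
      have "(\<Sum>k\<in>E. of_int (e (\<sigma> k)) * R k) = 0" using e(2) by (intro 2) (simp add: reindex)
      hence "\<forall>k\<in>E. e (\<sigma> k) = 0"
        using free[unfolded relation_free_def, rule_format, of "\<lambda>k. e (\<sigma> k)"] e(1) by simp
      thus "\<forall>k\<in>\<sigma> ` E. e k = 0" by simp
    qed
  qed
qed

section \<open>Lines and circuits\<close>

text \<open>A coset of the subgroup of order q, in coordinates: only the q-coordinate varies.\<close>

definition line :: "nat \<Rightarrow> int \<Rightarrow> int set" where
  "line q l = {k \<in> Zn n. [k = l] (mod int (n div q))}"

lemma inj_on_coord_line:
  assumes q: "prime q" "q dvd n"
  shows "inj_on (coord q) (line q l)"
proof (rule inj_onI)
  fix k k' assume k: "k \<in> line q l" "k' \<in> line q l" and "coord q k = coord q k'"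
  hence "[k = k'] (mod int q)" by (simp add: coord_eq_iff[OF q])
  moreover have "[k = k'] (mod int (n div q))" using k by (auto simp: line_def cong_def)
  ultimately have "[k = k'] (mod int n)" by (rule cong_mod_quotientI[OF q])
  thus "k = k'" using k by (auto simp: line_def intro: Zn_cong_imp_eq)
qed

lemma card_line:
  assumes q: "prime q" "q dvd n"
  shows "card (line q l) = q"
proof -
  have "coord q ` line q l = Zsub n q"
  proof
    show "coord q ` line q l \<subseteq> Zsub n q" using coord[OF q] by auto
    show "Zsub n q \<subseteq> coord q ` line q l"
    proof
      fix x assume x: "x \<in> Zsub n q"
      obtain z where z: "z \<in> Zn n" "[z = l] (mod int (n div q))" "[z = x] (mod int q)"
        using chinese_remainder_Zn[OF q] .
      have "coord q z = x" using x z(3) by (intro coord_eqI[OF q]) (auto simp: cong_sym)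
      thus "x \<in> coord q ` line q l" using z by (auto simp: line_def)
    qed
  qed
  hence "card (line q l) = card (Zsub n q)"
    using card_image[OF inj_on_coord_line[OF q, of l]] by simp
  thus ?thesis using card_Zsub[OF n_pos q(2)] by simp
qed

text \<open>On a coset of the subgroup of order q the roots of unity form a geometric progression.\<close>

lemma sum_line:
  assumes q: "prime q" "q dvd n"
  shows "(\<Sum>k\<in>line q l. R k) = 0"
proof -
  define m where "m = n div q"
  have n: "n = m * q" using prime_quotient(2)[OF q] by (simp add: m_def)
  have q1: "q > 1" using q(1) prime_gt_1_nat by blast
  have m0: "m > 0" using n n_pos by (auto intro!: Nat.gr0I)
  let ?f = "\<lambda>s. (l + int s * int m) mod int n"
  have "line q l = ?f ` {..<q}"
  proof (intro equalityI subsetI)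
    fix k assume k: "k \<in> line q l"
    hence "int m dvd k - l" by (auto simp: line_def m_def cong_iff_dvd_diff)
    then obtain t where t: "k = l + int m * t" by (metis diff_eq_eq add.commute dvdE)
    have "int n dvd int m * t - int m * (t mod int q)"
      unfolding n by (simp add: right_diff_distrib[symmetric] minus_mod_eq_mult_div)
    hence "[k = l + int (nat (t mod int q)) * int m] (mod int n)"
      using q1 by (simp add: t cong_iff_dvd_diff mult.commute)
    moreover have "k mod int n = k" using k n_pos by (simp add: line_def mem_Zn)
    ultimately have "k = ?f (nat (t mod int q))" by (simp add: cong_def)
    moreover have "nat (t mod int q) < q" using q1 by (simp add: nat_less_iff)
    ultimately show "k \<in> ?f ` {..<q}" by blast
  next
    fix k assume "k \<in> ?f ` {..<q}"
    then obtain s where s: "k = ?f s" by blast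
    have "[k = l + int s * int m] (mod int m)"
      unfolding s n by (rule cong_dvd_modulus[of _ _ "int (m * q)"]) (auto simp: cong_def)
    thus "k \<in> line q l" using n_pos by (simp add: s line_def mem_Zn m_def cong_def)
  qed
  moreover from this have "inj_on ?f {..<q}"
    using card_line[OF q, of l] by (intro eq_card_imp_inj_on) auto
  ultimately have "(\<Sum>k\<in>line q l. R k) = (\<Sum>s<q. R (?f s))"
    by (simp add: sum.reindex)
  also have "\<dots> = (\<Sum>s<q. R l * R (int s * (int m - 0)))"
    by (intro sum.cong refl, subst root_of_unity_add[symmetric], rule root_of_unity_cong[OF n_pos])
      (simp add: cong_def)
  also have "\<dots> = R l * (\<Sum>s<q. R (int s * (int m - 0)))" by (simp only: sum_distrib_left)
  also have "(\<Sum>s<q. R (int s * (int m - 0))) = 0"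
  proof -
    have "m < n" using m0 q1 by (subst n) simp
    hence "int m \<in> Zsub n q" "0 \<in> Zsub n q"
      using n_pos by (auto simp: Zsub_def mem_Zn simp flip: m_def)
    from sum_root_of_unity_powers[OF q this] show ?thesis using m0 by simp
  qed
  finally show ?thesis by simp
qed

text \<open>The term is that of matroid theory: a minimal dependent set.\<close>

definition circuit :: "int set \<Rightarrow> int set \<Rightarrow> bool" where
  "circuit U E \<longleftrightarrow> E \<subseteq> Zn n \<and> \<not> relation_free U E \<and> (\<forall>F. F \<subset> E \<longrightarrow> relation_free U F)"

lemma slice_empty: "x \<notin> (\<lambda>i. coord q (u i)) ` I \<Longrightarrow> slice q I c u x = 0"
  unfolding slice_def by (rule sum.neutral) auto

lemma slice_singleton:
  assumes "{i \<in> I. coord q (u i) = x} = {k}"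
  shows "slice q I c u x = of_int (c k) * R (u k - x)"
  by (simp add: slice_def assms)

text \<open>All coefficients 1 give a relation. A proper subset misses a slice, and so all slices vanish; each
  of them has at most one term.\<close>

lemma circuit_line:
  assumes q: "prime q" "q dvd n" and U: "1 \<in> U"
  shows "circuit U (line q l)"
  unfolding circuit_def
proof (intro conjI allI impI)
  show "line q l \<subseteq> Zn n" by (auto simp: line_def)
  have "line q l \<noteq> {}" using card_line[OF q, of l] prime_gt_0_nat[OF q(1)] by auto
  moreover have "(\<Sum>k\<in>line q l. of_int 1 * R k) = 0" using sum_line[OF q] by simp
  ultimately show "\<not> relation_free U (line q l)"
    using U unfolding relation_free_def by (auto intro!: exI[of _ "\<lambda>_. 1"])
  fix F assume F: "F \<subset> line q l"
  then obtain k0 where k0: "k0 \<in> line q l" "k0 \<notin> F" by blast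
  have fin: "finite F" using F finite_Zn by (auto simp: line_def intro: finite_subset)
  note inj = inj_onD[OF inj_on_coord_line[OF q, of l]]
  show "relation_free U F"
    unfolding relation_free_def
  proof (intro allI impI ballI, elim conjE)
    fix e k assume e: "(\<Sum>k\<in>F. of_int (e k) * R k) = 0" and k: "k \<in> F"
    have "coord q k0 \<notin> coord q ` F" using inj k0 F by blast
    hence "slice q F e (\<lambda>i. i) (coord q k0) = 0" by (rule slice_empty)
    moreover have "{i \<in> F. coord q i = coord q k} = {k}" using inj k F by blast
    hence "slice q F e (\<lambda>i. i) (coord q k) = of_int (e k) * R (k - coord q k)"
      by (rule slice_singleton)
    ultimately show "e k = 0"
      using slice_eq[OF q fin e coord(1)[OF q] coord(1)[OF q], of k k0] by simp
  qed
qed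

lemma odd_power_inj:
  fixes a b :: int
  assumes "odd m" "a ^ m = b ^ m"
  shows "a = b"
proof -
  have "root m (of_int a ^ m) = root m (of_int b ^ m)"
    using assms(2) by (metis of_int_power)
  thus ?thesis using assms(1) by (simp add: odd_real_root_power_cancel)
qed

text \<open>If some r-coordinate does not occur in E, then one slice of the relation is empty, so all slices
  vanish. Hence the points of E sharing their r-coordinate with a point of nonzero coefficient are
  dependent by themselves, and by minimality they are all of E. Otherwise every r-coordinate occurs,
  which forces r = q and exactly one point for each. Two of these one-term slices being equal, the
  ratio of their roots of unity is rational, and since n is odd it is 1; for even n it could be -1.\<close>

lemma circuit_small:
  assumes U: "0 \<in> U" and odd: "odd n" and E: "circuit U E" "card E = q"
    and r: "prime r" "r dvd n" "q \<le> r"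
  shows "(\<forall>k\<in>E. \<forall>l\<in>E. [k = l] (mod int r)) \<or> r = q \<and> (\<forall>k\<in>E. \<forall>l\<in>E. [k = l] (mod int (n div q)))"
proof -
  have EZ: "E \<subseteq> Zn n" using E(1) by (simp add: circuit_def)
  have fin: "finite E" using EZ finite_Zn finite_subset by blast
  obtain e where e: "\<forall>k\<in>E. e k \<in> U" "(\<Sum>k\<in>E. of_int (e k) * R k) = 0" "\<exists>k\<in>E. e k \<noteq> 0"
    using E(1) unfolding circuit_def relation_free_def by blast
  then obtain k0 where k0: "k0 \<in> E" "e k0 \<noteq> 0" by blast
  let ?V = "slice r E e (\<lambda>k. k)"
  note V = slice_eq[OF r(1,2) fin e(2)]
  show ?thesis
  proof (cases "Zsub n r \<subseteq> coord r ` E")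
    case False
    then obtain x where x: "x \<in> Zsub n r" "x \<notin> coord r ` E" by blast
    have "?V x = 0" using x(2) by (rule slice_empty)
    define F where "F = {k\<in>E. coord r k = coord r k0}"
    have "(\<Sum>k\<in>F. of_int (e k) * R k) = R (coord r k0) * ?V (coord r k0)"
      unfolding slice_def F_def sum_distrib_left
      by (intro sum.cong refl) (simp add: mult.left_commute flip: root_of_unity_add)
    also have "\<dots> = 0" using V[OF x(1) coord(1)[OF r(1,2)], of k0] \<open>?V x = 0\<close> by simp
    finally have "\<not> relation_free U F"
      using k0 e(1) unfolding relation_free_def F_def by blast
    moreover have "F \<subseteq> E" by (auto simp: F_def)
    ultimately have "F = E" using E(1) unfolding circuit_def by (metis psubsetI)
    hence "\<forall>k\<in>E. coord r k = coord r k0" unfolding F_def by blast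
    hence "\<forall>k\<in>E. \<forall>l\<in>E. [k = l] (mod int r)" by (metis coord_eq_iff[OF r(1,2)])
    thus ?thesis ..
  next
    case True
    hence img: "coord r ` E = Zsub n r" using coord(1)[OF r(1,2)] by blast
    have "r \<le> card E" using card_image_le[OF fin, of "coord r"] card_Zsub[OF n_pos r(2)] img by simp
    hence rq: "r = q" using E(2) r(3) by simp
    have inj: "inj_on (coord r) E"
      using fin img E(2) card_Zsub[OF n_pos r(2)] rq by (intro eq_card_imp_inj_on) auto
    have Vk: "?V (coord r k) = of_int (e k) * R (k - coord r k)" if "k \<in> E" for k
      by (rule slice_singleton) (use inj that in \<open>auto dest: inj_onD\<close>)
    have pow: "R j ^ n = 1" for j by (simp add: root_of_unity_power root_of_unity_multiple n_pos)
    have nz: "e k \<noteq> 0" if "k \<in> E" for k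
      using V[OF coord(1)[OF r(1,2)] coord(1)[OF r(1,2)], of k k0] Vk[OF that] Vk[OF k0(1)] k0(2) by auto
    have "[k = l] (mod int (n div q))" if kl: "k \<in> E" "l \<in> E" for k l
    proof -
      have eq: "of_int (e k) * R (k - coord r k) = of_int (e l) * R (l - coord r l)"
        using V[OF coord(1)[OF r(1,2)] coord(1)[OF r(1,2)], of k l] Vk kl by simp
      \<comment> \<open>n-th powers remove the roots of unity, and odd powers of integers determine their base\<close>
      hence "(of_int (e k) * R (k - coord r k)) ^ n = (of_int (e l) * R (l - coord r l)) ^ n"
        by simp
      hence "(of_int (e k ^ n) :: complex) = of_int (e l ^ n)" by (simp add: power_mult_distrib pow)
      hence "e k ^ n = e l ^ n" by (simp only: of_int_eq_iff)
      hence "e k = e l" using odd_power_inj[OF odd] by blast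
      hence "R (k - coord r k) = R (l - coord r l)" using eq nz[OF kl(2)] by simp
      hence "[k - coord r k = l - coord r l] (mod int n)" using root_of_unity_eq_iff[OF n_pos] by blast
      hence 1: "[k - coord r k = l - coord r l] (mod int (n div r))"
        by (rule cong_dvd_modulus) (use prime_quotient(2)[OF r(1,2)] in \<open>metis dvd_triv_left int_dvd_int_iff\<close>)
      have "[coord r k = coord r l] (mod int (n div r))"
        using coord(1)[OF r(1,2)] by (metis cong_sym cong_trans mem_Zsub_iff)
      from cong_add[OF 1 this] show ?thesis by (simp add: rq)
    qed
    thus ?thesis using rq by blast
  qed
qed

section \<open>Permutations preserving relation-free sets\<close>

text \<open>Join k to l by a path that changes one coordinate with index in J at a time.\<close>

lemma cong_path:
  assumes J: "finite J" "J \<subseteq> prime_factors n"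
    and lines: "\<And>r k l. r \<in> J \<Longrightarrow> k \<in> Zn n \<Longrightarrow> l \<in> Zn n \<Longrightarrow> [k = l] (mod int (n div r)) \<Longrightarrow>
           [\<tau> k = \<tau> l] (mod int (n div r))"
    and kl: "k \<in> Zn n" "l \<in> Zn n" and eq: "\<And>q. q \<in> prime_factors n - J \<Longrightarrow> [k = l] (mod int q)"
    and q: "q \<in> prime_factors n - J"
  shows "[\<tau> k = \<tau> l] (mod int q)"
  using J lines kl eq q
proof (induction J arbitrary: k rule: finite_induct)
  case empty
  have "[k = l] (mod int n)" using empty.prems n_pos by (intro cong_modI) (auto simp: prime_factors_dvd)
  hence "k = l" using empty.prems by (intro Zn_cong_imp_eq)
  thus ?case by simp
next
  case (insert r J)
  have r: "prime r" "r dvd n" using insert.prems(1) by (auto simp: prime_factors_dvd)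
  obtain z where z: "z \<in> Zn n" "[z = k] (mod int (n div r))" "[z = l] (mod int r)"
    using chinese_remainder_Zn[OF r] .
  have quot: "[a = b] (mod int s)" if "s \<in> prime_factors n" "s \<noteq> r" "[a = b] (mod int (n div r))" for a b s
    by (rule cong_quotientD[OF r _ _ that(2,3)]) (use that in \<open>auto simp: prime_factors_dvd\<close>)
  have "[\<tau> z = \<tau> l] (mod int q)"
  proof (rule insert.IH)
    show "J \<subseteq> prime_factors n" using insert.prems by blast
    show "q \<in> prime_factors n - J" using insert.prems by blast
    show "[\<tau> k = \<tau> l] (mod int (n div s))"
      if "s \<in> J" "k \<in> Zn n" "l \<in> Zn n" "[k = l] (mod int (n div s))" for s k l
      using insert.prems(2) that by blast
    show "z \<in> Zn n" "l \<in> Zn n" by fact+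
    show "[z = l] (mod int s)" if "s \<in> prime_factors n - J" for s
    proof (cases "s = r")
      case False
      hence "[z = k] (mod int s)" using quot z(2) that by blast
      moreover have "[k = l] (mod int s)" using False that by (intro insert.prems(5)) auto
      ultimately show ?thesis by (rule cong_trans)
    qed (use z in simp)
  qed
  moreover have "[\<tau> z = \<tau> k] (mod int q)"
    using quot[of q "\<tau> z" "\<tau> k"] insert.prems(2)[OF _ z(1) insert.prems(3) z(2)] insert.prems(6) by auto
  ultimately show ?case by (metis cong_sym cong_trans)
qed

lemma circuit_image:
  assumes \<sigma>: "\<sigma> permutes Zn n" "\<And>E. E \<subseteq> Zn n \<Longrightarrow> relation_free U (\<sigma> ` E) \<longleftrightarrow> relation_free U E"
    and E: "circuit U E"
  shows "circuit U (\<sigma> ` E)"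
  unfolding circuit_def
proof (intro conjI allI impI)
  have EZ: "E \<subseteq> Zn n" using E by (simp add: circuit_def)
  show "\<sigma> ` E \<subseteq> Zn n" using EZ \<sigma>(1) by (metis image_mono permutes_image)
  show "\<not> relation_free U (\<sigma> ` E)" using E \<sigma>(2)[OF EZ] by (simp add: circuit_def)
  fix F assume F: "F \<subset> \<sigma> ` E"
  then obtain F' where F': "F' \<subseteq> E" "F = \<sigma> ` F'" by (metis psubset_imp_subset subset_imageE)
  hence "F' \<subset> E" using F by blast
  hence "relation_free U F'" "F' \<subseteq> Zn n" using E by (auto simp: circuit_def)
  thus "relation_free U F" using \<sigma>(2) F'(2) by blast
qed

text \<open>Induction on the prime q. The image of a q-line is a circuit with q points. If it were not a q-line,
  then its points would agree in all coordinates belonging to primes from q on, and would be joined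
  by paths along r-lines with r < q. The inverse permutation preserves those lines by the induction
  hypothesis, so that the points of the original q-line would agree in their q-coordinate.\<close>

lemma permutation_preserves_lines:
  assumes U: "0 \<in> U" "1 \<in> U" and odd: "odd n"
    and "prime q" "q dvd n" "\<sigma> permutes Zn n"
    and "\<And>E. E \<subseteq> Zn n \<Longrightarrow> relation_free U (\<sigma> ` E) \<longleftrightarrow> relation_free U E"
    and "k \<in> Zn n" "l \<in> Zn n" "[k = l] (mod int (n div q))"
  shows "[\<sigma> k = \<sigma> l] (mod int (n div q))"
  using assms(4-)
proof (induction q arbitrary: \<sigma> k l rule: less_induct)
  case (less q)
  note q = less.prems(1,2) and \<sigma> = less.prems(3,4) and kl = less.prems(5,6,7)
  define E where "E = \<sigma> ` line q l"
  have E: "circuit U E" unfolding E_def by (rule circuit_image[OF \<sigma> circuit_line[OF q U(2)]])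
  have "inj_on \<sigma> (line q l)" using permutes_inj[OF \<sigma>(1)] inj_on_subset by blast
  hence cE: "card E = q" unfolding E_def using card_line[OF q] by (simp add: card_image)
  have mem: "\<sigma> k \<in> E" "\<sigma> l \<in> E" using kl by (auto simp: E_def line_def)
  show ?case
  proof (rule ccontr)
    assume neg: "\<not> [\<sigma> k = \<sigma> l] (mod int (n div q))"
    have big: "[\<sigma> k = \<sigma> l] (mod int r)" if "prime r" "r dvd n" "q \<le> r" for r
      using circuit_small[OF U(1) odd E cE that] mem neg by blast
    define \<tau> where "\<tau> = inv_into UNIV \<sigma>"
    have \<tau>p: "\<tau> permutes Zn n" unfolding \<tau>_def using \<sigma>(1) by (rule permutes_inv)
    have \<tau>\<sigma>: "\<tau> (\<sigma> x) = x" "\<sigma> (\<tau> x) = x" for x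
      using permutes_inverses[OF \<sigma>(1)] by (simp_all add: \<tau>_def)
    have \<tau>free: "relation_free U (\<tau> ` F) \<longleftrightarrow> relation_free U F" if "F \<subseteq> Zn n" for F
    proof -
      have "\<tau> ` F \<subseteq> Zn n" using that \<tau>p by (metis image_mono permutes_image)
      from \<sigma>(2)[OF this] show ?thesis by (simp add: image_image \<tau>\<sigma>)
    qed
    define J where "J = {r \<in> prime_factors n. r < q}"
    have "[\<tau> (\<sigma> k) = \<tau> (\<sigma> l)] (mod int q)"
    proof (rule cong_path[where \<tau> = \<tau> and k = "\<sigma> k" and l = "\<sigma> l"])
      show "finite J" "J \<subseteq> prime_factors n" by (auto simp: J_def)
      show "q \<in> prime_factors n - J" using q n_pos by (auto simp: J_def prime_factors_dvd)
      show "\<sigma> k \<in> Zn n" "\<sigma> l \<in> Zn n" using kl \<sigma>(1) by (auto simp: permutes_in_image)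
      show "[\<sigma> k = \<sigma> l] (mod int r)" if "r \<in> prime_factors n - J" for r
        by (rule big) (use that in \<open>auto simp: J_def prime_factors_dvd\<close>)
      show "[\<tau> x = \<tau> y] (mod int (n div r))"
        if "r \<in> J" "x \<in> Zn n" "y \<in> Zn n" "[x = y] (mod int (n div r))" for r x y
        by (rule less.IH[OF _ _ _ \<tau>p \<tau>free that(2-4)])
          (use that(1) in \<open>auto simp: J_def prime_factors_dvd\<close>)
    qed
    hence "[k = l] (mod int q)" by (simp add: \<tau>\<sigma>)
    hence "k = l" using cong_mod_quotientI[OF q _ kl(3)] Zn_cong_imp_eq[OF kl(1,2)] by blast
    thus False using neg by simp
  qed
qed

text \<open>Points with the same q-coordinate are joined by lines in the other directions, and moving along
  such a line keeps the q-coordinate of the image.\<close>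

lemma permutation_preserves_coords:
  assumes U: "0 \<in> U" "1 \<in> U" and odd: "odd n" and q: "prime q" "q dvd n"
    and \<sigma>: "\<sigma> permutes Zn n" "\<And>E. E \<subseteq> Zn n \<Longrightarrow> relation_free U (\<sigma> ` E) \<longleftrightarrow> relation_free U E"
    and kl: "k \<in> Zn n" "l \<in> Zn n" "[k = l] (mod int q)"
  shows "[\<sigma> k = \<sigma> l] (mod int q)"
proof (rule cong_path[where J = "prime_factors n - {q}" and \<tau> = \<sigma> and k = k and l = l])
  show "[\<sigma> x = \<sigma> y] (mod int (n div r))"
    if "r \<in> prime_factors n - {q}" "x \<in> Zn n" "y \<in> Zn n" "[x = y] (mod int (n div r))" for r x y
    by (rule permutation_preserves_lines[OF U odd _ _ \<sigma> that(2-4)])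
      (use that(1) in \<open>auto simp: prime_factors_dvd\<close>)
qed (use kl q n_pos in \<open>auto simp: prime_factors_dvd\<close>)

end

section \<open>Product permutations\<close>

locale prime_product = squarefree_modulus +
  fixes K :: nat and p :: "nat \<Rightarrow> nat"
  assumes primes: "\<forall>j\<in>{1..K}. prime (p j)" and n_eq: "n = (\<Prod>j=1..K. p j)"
begin

lemma p_prime: "j \<in> {1..K} \<Longrightarrow> prime (p j)" "j \<in> {1..K} \<Longrightarrow> p j dvd n"
  using primes n_eq by (auto intro: dvd_prodI)

lemma inj_p: "inj_on p {1..K}"
proof (rule inj_onI, rule ccontr)
  fix i j assume ij: "i \<in> {1..K}" "j \<in> {1..K}" "p i = p j" "i \<noteq> j"
  have "n = p i * (p j * (\<Prod>k\<in>{1..K}-{i}-{j}. p k))"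
    using ij by (simp add: n_eq prod.remove)
  hence "(p i)\<^sup>2 dvd n" using ij(3) by (simp add: power2_eq_square mult.assoc)
  hence "is_unit (p i)" using sqf squarefreeD by blast
  thus False using p_prime(1)[OF ij(1)] by simp
qed

lemma prime_factors_n: "prime_factors n = p ` {1..K}"
proof -
  have "\<exists>j\<in>{1..K}. q = p j" if "prime q" "q dvd n" for q
  proof -
    have "q dvd (\<Prod>j=1..K. p j)" using that(2) by (simp only: n_eq)
    hence "\<exists>j\<in>{1..K}. q dvd p j"
      using prime_dvd_prod_iff[OF finite_atLeastAtMost that(1)] by blast
    thus ?thesis using p_prime(1) that(1) primes_dvd_imp_eq by blast
  qed
  thus ?thesis using n_pos p_prime by (auto simp: prime_factors_dvd)
qed

lemma Zjoin_cong:
  assumes y: "y \<in> Zprod n K p" and j: "j \<in> {1..K}"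
  shows "[Zjoin n K y = y j] (mod int (p j))"
proof -
  have "[Zjoin n K y = (\<Sum>i=1..K. y i)] (mod int n)" by (simp add: Zjoin_def cong_def)
  hence "[Zjoin n K y = (\<Sum>i=1..K. y i)] (mod int (p j))"
    using p_prime(2)[OF j] cong_dvd_modulus int_dvd_int_iff by blast
  also have "(\<Sum>i=1..K. y i) = y j + (\<Sum>i\<in>{1..K}-{j}. y i)" using j by (simp add: sum.remove)
  also have "[\<dots> = y j + (\<Sum>i\<in>{1..K}-{j}. 0)] (mod int (p j))"
  proof (intro cong_add cong_sum cong_refl)
    fix i assume i: "i \<in> {1..K} - {j}"
    have "[y i = 0] (mod int (n div p i))" using y i by (auto simp: mem_Zsub_iff PiE_iff)
    moreover have "p j \<noteq> p i" "i \<in> {1..K}" using i j inj_onD[OF inj_p] by blast+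
    ultimately show "[y i = 0] (mod int (p j))"
      using cong_quotientD[OF p_prime p_prime] j by blast
  qed
  finally show ?thesis by simp
qed

lemma Zjoin_coord:
  assumes "k \<in> Zn n"
  shows "(\<lambda>j\<in>{1..K}. coord (p j) k) \<in> Zprod n K p" "Zjoin n K (\<lambda>j\<in>{1..K}. coord (p j) k) = k"
proof -
  let ?x = "\<lambda>j\<in>{1..K}. coord (p j) k"
  show x: "?x \<in> Zprod n K p" using coord(1)[OF p_prime] by auto
  have "[Zjoin n K ?x = k] (mod int n)"
  proof (rule cong_modI)
    fix q assume "prime q" "q dvd n"
    hence "q \<in> prime_factors n" using n_pos by (simp add: prime_factors_dvd)
    then obtain j where j: "j \<in> {1..K}" "q = p j" unfolding prime_factors_n by blast
    show "[Zjoin n K ?x = k] (mod int q)"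
      using Zjoin_cong[OF x j(1)] coord(2)[OF p_prime[OF j(1)], of k] j by (auto intro: cong_trans)
  qed
  moreover have "Zjoin n K ?x \<in> Zn n" using n_pos by (simp add: Zjoin_def mem_Zn)
  ultimately show "Zjoin n K ?x = k" using Zn_cong_imp_eq assms by blast
qed

lemma prod_perm_eq:
  assumes "k \<in> Zn n"
  shows "prod_perm n K p s k = Zjoin n K (\<lambda>j\<in>{1..K}. s j (coord (p j) k))"
proof -
  have "prod_perm n K p s (Zjoin n K (\<lambda>j\<in>{1..K}. coord (p j) k)) =
      Zjoin n K (\<lambda>j\<in>{1..K}. s j ((\<lambda>j\<in>{1..K}. coord (p j) k) j))"
    by (rule prod_perm_Zjoin[OF sqf primes n_eq Zjoin_coord(1)[OF assms]])
  thus ?thesis unfolding Zjoin_coord(2)[OF assms] by (simp cong: restrict_cong)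
qed

lemma prod_perm_cong:
  assumes "k \<in> Zn n" and s: "\<forall>j\<in>{1..K}. s j permutes Zsub n (p j)" and j: "j \<in> {1..K}"
  shows "[prod_perm n K p s k = s j (coord (p j) k)] (mod int (p j))"
proof -
  have "(\<lambda>j\<in>{1..K}. s j (coord (p j) k)) \<in> Zprod n K p"
    using s coord(1)[OF p_prime] by (auto simp: permutes_in_image)
  from Zjoin_cong[OF this j] show ?thesis using j by (simp add: prod_perm_eq[OF assms(1)])
qed

lemma prod_perm_preserves_relation_free:
  assumes s: "\<forall>j\<in>{1..K}. s j permutes Zsub n (p j)" and E: "E \<subseteq> Zn n"
  shows "relation_free U (prod_perm n K p s ` E) \<longleftrightarrow> relation_free U E"
proof (rule relation_free_image_coords[OF E, where \<pi> = "\<lambda>q. s (inv_into {1..K} p q)"])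
  show "inj_on (prod_perm n K p s) E"
    using permutes_inj[OF prod_perm_permutes[OF sqf primes n_eq s]] inj_on_subset by blast
  have inv: "inv_into {1..K} p (p j) = j" if "j \<in> {1..K}" for j
    using inj_p that by (rule inv_into_f_f)
  show "s (inv_into {1..K} p q) permutes Zsub n q" if "q \<in> prime_factors n" for q
    using that s inv unfolding prime_factors_n by auto
  show "[prod_perm n K p s k = s (inv_into {1..K} p q) (coord q k)] (mod int q)"
    if k: "k \<in> E" and q: "q \<in> prime_factors n" for k q
  proof -
    obtain j where j: "j \<in> {1..K}" "q = p j" using q unfolding prime_factors_n by blast
    show ?thesis using prod_perm_cong[OF _ s j(1), of k] k E j inv by auto
  qed
qed

text \<open>The j-th factor acts on the subgroup of order p j as the permutation does, followed by the
  projection to that subgroup.\<close>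

lemma coordinatewise_imp_prod_perm:
  assumes \<sigma>: "\<sigma> permutes Zn n"
    and co: "\<And>j k l. j \<in> {1..K} \<Longrightarrow> k \<in> Zn n \<Longrightarrow> l \<in> Zn n \<Longrightarrow> [k = l] (mod int (p j)) \<Longrightarrow>
               [\<sigma> k = \<sigma> l] (mod int (p j))"
  shows "\<exists>s. (\<forall>j\<in>{1..K}. s j permutes Zsub n (p j)) \<and> \<sigma> = prod_perm n K p s"
proof -
  define s where "s j x = (if x \<in> Zsub n (p j) then coord (p j) (\<sigma> x) else x)" for j x
  have s_coord: "s j (coord (p j) k) = coord (p j) (\<sigma> k)" if j: "j \<in> {1..K}" and k: "k \<in> Zn n" for j k
  proof -
    note c = coord[OF p_prime[OF j], of k]
    have "[\<sigma> (coord (p j) k) = \<sigma> k] (mod int (p j))"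
      using c by (intro co j k) (auto simp: mem_Zsub_iff)
    thus ?thesis using c by (simp add: s_def coord_eq_iff[OF p_prime[OF j]])
  qed
  have perm: "s j permutes Zsub n (p j)" if j: "j \<in> {1..K}" for j
  proof (rule bij_imp_permutes)
    have "Zsub n (p j) \<subseteq> s j ` Zsub n (p j)"
    proof
      fix y assume y: "y \<in> Zsub n (p j)"
      define k where "k = inv_into UNIV \<sigma> y"
      have k: "\<sigma> k = y" "k \<in> Zn n"
        using y permutes_inverses(1)[OF \<sigma>] permutes_in_image[OF permutes_inv[OF \<sigma>], of y]
        by (auto simp: k_def mem_Zsub_iff)
      have "s j (coord (p j) k) = y"
        using s_coord[OF j k(2)] k(1) y coord_Zsub[OF p_prime[OF j]] by simp
      thus "y \<in> s j ` Zsub n (p j)" using coord(1)[OF p_prime[OF j], of k] by blast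
    qed
    moreover have "s j ` Zsub n (p j) \<subseteq> Zsub n (p j)" using coord(1)[OF p_prime[OF j]] by (auto simp: s_def)
    ultimately have "s j ` Zsub n (p j) = Zsub n (p j)" by blast
    thus "bij_betw (s j) (Zsub n (p j)) (Zsub n (p j))"
      by (simp add: bij_betw_def finite_surj_inj)
  qed (simp add: s_def)
  have "\<sigma> k = prod_perm n K p s k" for k
  proof (cases "k \<in> Zn n")
    case True
    hence "\<sigma> k \<in> Zn n" using \<sigma> by (simp add: permutes_in_image)
    from Zjoin_coord(2)[OF this]
    have "\<sigma> k = Zjoin n K (\<lambda>j\<in>{1..K}. coord (p j) (\<sigma> k))" by simp
    also have "(\<lambda>j\<in>{1..K}. coord (p j) (\<sigma> k)) = (\<lambda>j\<in>{1..K}. s j (coord (p j) k))"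
      using s_coord True by (intro restrict_ext) simp
    also have "Zjoin n K \<dots> = prod_perm n K p s k" by (rule prod_perm_eq[OF True, symmetric])
    finally show ?thesis .
  next
    case False
    thus ?thesis using permutes_not_in[OF \<sigma>] by (simp add: prod_perm_def)
  qed
  thus ?thesis using perm by blast
qed

lemma relation_free_preserving_imp_prod_perm:
  assumes "0 \<in> U" "1 \<in> U" "odd n" "\<sigma> permutes Zn n"
    and "\<And>E. E \<subseteq> Zn n \<Longrightarrow> relation_free U (\<sigma> ` E) \<longleftrightarrow> relation_free U E"
  shows "\<exists>s. (\<forall>j\<in>{1..K}. s j permutes Zsub n (p j)) \<and> \<sigma> = prod_perm n K p s"
  using permutation_preserves_coords[OF assms(1-3) p_prime assms(4,5)]
  by (intro coordinatewise_imp_prod_perm[OF assms(4)])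

lemma preserves_class_iff:
  assumes \<sigma>: "\<sigma> permutes Zn n"
  shows "preserves_class n \<sigma> (Zn_quasi_independent n) \<longleftrightarrow>
           (\<forall>E\<subseteq>Zn n. relation_free {0, 1, -1} (\<sigma> ` E) \<longleftrightarrow> relation_free {0, 1, -1} E)"
    and "preserves_class n \<sigma> (Zn_independent n) \<longleftrightarrow>
           (\<forall>E\<subseteq>Zn n. relation_free UNIV (\<sigma> ` E) \<longleftrightarrow> relation_free UNIV E)"
proof -
  have "\<sigma> ` E \<subseteq> Zn n" if "E \<subseteq> Zn n" for E using that \<sigma> by (metis image_mono permutes_image)
  thus "preserves_class n \<sigma> (Zn_quasi_independent n) \<longleftrightarrow>
           (\<forall>E\<subseteq>Zn n. relation_free {0, 1, -1} (\<sigma> ` E) \<longleftrightarrow> relation_free {0, 1, -1} E)"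
    and "preserves_class n \<sigma> (Zn_independent n) \<longleftrightarrow>
           (\<forall>E\<subseteq>Zn n. relation_free UNIV (\<sigma> ` E) \<longleftrightarrow> relation_free UNIV E)"
    unfolding preserves_class_def by (metis Zn_quasi_independent_iff, metis Zn_independent_iff)
qed

end

theorem theorem1p2p1:
  fixes n K :: nat and p :: "nat \<Rightarrow> nat"
  assumes "odd n" and "squarefree n"
    and "\<forall>j\<in>{1..K}. prime (p j)" and "n = (\<Prod>j=1..K. p j)"
  shows "(\<forall>s. (\<forall>j\<in>{1..K}. s j permutes Zsub n (p j)) \<longrightarrow>
            preserves_class n (prod_perm n K p s) (Zn_quasi_independent n) \<and>
            preserves_class n (prod_perm n K p s) (Zn_independent n)) \<and>
         (\<forall>\<sigma>. \<sigma> permutes Zn n \<and>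
            (preserves_class n \<sigma> (Zn_quasi_independent n) \<or>
             preserves_class n \<sigma> (Zn_independent n)) \<longrightarrow>
            (\<exists>s. (\<forall>j\<in>{1..K}. s j permutes Zsub n (p j)) \<and> \<sigma> = prod_perm n K p s))"
proof -
  interpret prime_product n K p by unfold_locales (use assms in auto)
  show ?thesis
  proof (intro conjI allI impI)
    fix s assume s: "\<forall>j\<in>{1..K}. s j permutes Zsub n (p j)"
    note perm = prod_perm_permutes[OF sqf primes n_eq s]
    show "preserves_class n (prod_perm n K p s) (Zn_quasi_independent n)"
      "preserves_class n (prod_perm n K p s) (Zn_independent n)"
      unfolding preserves_class_iff[OF perm] using prod_perm_preserves_relation_free[OF s] by blast+
  next
    fix \<sigma>
    assume \<sigma>: "\<sigma> permutes Zn n \<and>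
            (preserves_class n \<sigma> (Zn_quasi_independent n) \<or>
             preserves_class n \<sigma> (Zn_independent n))"
    hence perm: "\<sigma> permutes Zn n" by blast
    obtain U where "U = {0, 1, -1} \<or> U = UNIV"
      and "\<forall>E\<subseteq>Zn n. relation_free U (\<sigma> ` E) \<longleftrightarrow> relation_free U E"
      using \<sigma> unfolding preserves_class_iff[OF perm] by blast
    thus "\<exists>s. (\<forall>j\<in>{1..K}. s j permutes Zsub n (p j)) \<and> \<sigma> = prod_perm n K p s"
      using assms(1) perm by (intro relation_free_preserving_imp_prod_perm[of U]) auto
  qed
qed

end
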